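(* Let $p$ be a prime, let $b\in\mathbb{N}$ and $g\in\mathbb{Z}^+$. Let $P,Q,X,Y$ be integers with $$P>Q>0,\quad X\ge 3b,\quad Y\ge\max\{b,p^{4P}\}.$$ For integers $h,k,l,w,x,y$ define $$L:=lY,\quad U:=PLX,\quad V:=4gwY,\quad W:=bw,\quad K:=QX+1+k(U^PV-2),$$ $$A:=U^Q(V+1),\quad B:=PX+1,\quad C:=B+(A-2)h,$$ $$D:=(A^2-4)C^2+4,\quad E:=C^2Dx,\quad F:=4(A^2-4)E^2+1,\quad G:=1+CDF-2(A+2)(A-2)^2E^2,$$ $$H:=C+BF+(2y-1)CF,\quad I:=(G^2-1)H^2+1.$$ Suppose there are integers $h,k,l,w,x,y$ with $lx\ne0$ such that $$DFI\in\square,\quad (U^{2P}V^2-4)K^2+4\in\square,\quad pA-p^2-1\ \text{divides}\ (p^2-1)WC-p(W^2-1),$$ and $4(C-KL)^2<K^2$. Then $b\in p\uparrow$ and $Y\mid\binom{PX}{QX}$.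
   Context: $\square=\{m^2:m\in\mathbb{Z}\}$; $p\uparrow=\{p^n:n\in\mathbb{N}\}$. *)

theory Defs
  imports Complex_Main "HOL-Computational_Algebra.Primes" "HOL-Computational_Algebra.Nth_Powers"
begin

definition powers_of :: "nat \<Rightarrow> nat set" where
  "powers_of p = {p ^ n | n. True}"

end

theory Submission imports Defs "HOL-Number_Theory.Cong"
begin

text \<open>
  Let \<open>u\<^sub>n(A)\<close> be the Lucas sequence with parameters \<open>(A, 1)\<close>; its terms are, up to sign, the
  solutions \<open>y\<close> of the Pell equation \<open>z\<^sup>2 = (A\<^sup>2 - 4) y\<^sup>2 + 4\<close>. The numbers \<open>D\<close>, \<open>F\<close>, \<open>I\<close> are pairwise
  coprime, so each of them is a square, which makes \<open>C\<close>, \<open>4 E\<close> and \<open>H\<close> terms of Lucas sequences;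
  the divisibility and periodicity properties of these sequences then give \<open>C = u\<^sub>B(A)\<close>. In the same
  way \<open>K\<close> is a term of the sequence for \<open>M = U\<^sup>P V\<close>, and since \<open>C / K\<close> has to be close to \<open>L\<close>, its
  index must be \<open>Q X + 1\<close>.

  Now \<open>C / K\<close> is close to \<open>(V + 1)\<^sup>P\<^sup>X / V\<^sup>Q\<^sup>X\<close>, so \<open>L\<close>, and hence \<open>A\<close>, is very large. Modulo
  \<open>p A - p\<^sup>2 - 1\<close> the roots of \<open>t\<^sup>2 - A t + 1\<close> are \<open>p\<close> and \<open>1 / p\<close>, and the divisibility
  hypothesis says that this modulus divides \<open>(W - p\<^sup>B) (p\<^sup>B W + 1)\<close>. As the modulus exceeds this
  product, \<open>W = b w = p\<^sup>B\<close>. Thus \<open>b\<close> is a power of \<open>p\<close>, and \<open>V\<close> is so large that \<open>L\<close> must be the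
  polynomial part of \<open>(V + 1)\<^sup>P\<^sup>X / V\<^sup>Q\<^sup>X\<close>, whose constant term is the binomial coefficient.
  Both \<open>V\<close> and \<open>L\<close> are multiples of \<open>Y\<close>.
\<close>


section \<open>Lucas sequences\<close>

fun lucas_u :: "int \<Rightarrow> nat \<Rightarrow> int" where
  "lucas_u A 0 = 0"
| "lucas_u A (Suc 0) = 1"
| "lucas_u A (Suc (Suc n)) = A * lucas_u A (Suc n) - lucas_u A n"

text \<open>The step from \<open>(c, y)\<close> to \<open>(y, A * y - c)\<close> preserves the form
  \<open>y\<^sup>2 - A * y * c + c\<^sup>2\<close>, and its value at \<open>(0, 1)\<close> is 1.
  This is the Pell equation written for neighbouring terms.\<close>

lemma lucas_u_invariant:
  "(lucas_u A (Suc n))\<^sup>2 - A * lucas_u A (Suc n) * lucas_u A n + (lucas_u A n)\<^sup>2 = 1"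
proof (induction n)
  case (Suc n)
  then show ?case by (simp add: power2_eq_square algebra_simps)
qed simp

lemma lucas_u_add_Suc:
  "lucas_u A (Suc (m + n)) = lucas_u A (Suc m) * lucas_u A (Suc n) - lucas_u A m * lucas_u A n"
proof (induction A m rule: lucas_u.induct)
  case (3 A m)
  have "lucas_u A (Suc (Suc (Suc m) + n)) = A * lucas_u A (Suc (Suc m + n)) - lucas_u A (Suc (m + n))"
    by simp
  also have "\<dots> = lucas_u A (Suc (Suc (Suc m))) * lucas_u A (Suc n)
      - lucas_u A (Suc (Suc m)) * lucas_u A n"
    unfolding "3.IH" by (simp add: algebra_simps)
  finally show ?case .
qed simp_all

text \<open>The addition formula with the predecessor of \<open>lucas_u A m\<close> rewritten as
  \<open>A * lucas_u A m - lucas_u A (Suc m)\<close>, so that \<open>m = 0\<close> is covered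
  too.\<close>

lemma lucas_u_add:
  "lucas_u A (m + n) = lucas_u A (Suc m) * lucas_u A n + lucas_u A m * lucas_u A (Suc n)
     - A * lucas_u A m * lucas_u A n"
proof (cases m)
  case (Suc k)
  then show ?thesis
    using lucas_u_add_Suc[of A k n] by (simp add: algebra_simps)
qed simp

lemma lucas_u_minus: "lucas_u (- A) (Suc n) = (- 1) ^ n * lucas_u A (Suc n)"
proof -
  have "lucas_u (- A) n = - ((- 1) ^ n * lucas_u A n)" for n
    by (induction A n rule: lucas_u.induct) (simp_all add: algebra_simps)
  then show ?thesis by simp
qed

section \<open>Growth, signs and dependence on the parameter\<close>

lemma lucas_u_growth:
  assumes "A \<ge> 2"
  shows "0 \<le> lucas_u A n \<and> lucas_u A n < lucas_u A (Suc n) \<and> (A - 1) * lucas_u A n \<le> lucas_u A (Suc n)"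
proof (induction n)
  case (Suc n)
  have "2 * lucas_u A (Suc n) \<le> A * lucas_u A (Suc n)"
    using assms Suc by (intro mult_right_mono) auto
  moreover have "(A - 1) * lucas_u A (Suc n) = A * lucas_u A (Suc n) - lucas_u A (Suc n)"
    by (simp add: algebra_simps)
  moreover have "lucas_u A (Suc (Suc n)) = A * lucas_u A (Suc n) - lucas_u A n"
    by simp
  ultimately show ?case using Suc by linarith
qed simp

lemma lucas_u_nonneg: "A \<ge> 2 \<Longrightarrow> 0 \<le> lucas_u A n"
  using lucas_u_growth by blast

lemma lucas_u_strict_mono: "A \<ge> 2 \<Longrightarrow> strict_mono (lucas_u A)"
  using lucas_u_growth by (simp add: strict_mono_Suc_iff)

lemma lucas_u_less_iff: "A \<ge> 2 \<Longrightarrow> lucas_u A m < lucas_u A n \<longleftrightarrow> m < n"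
  by (simp add: lucas_u_strict_mono strict_mono_less)

lemma lucas_u_le_iff: "A \<ge> 2 \<Longrightarrow> lucas_u A m \<le> lucas_u A n \<longleftrightarrow> m \<le> n"
  by (simp add: lucas_u_strict_mono strict_mono_less_eq)

lemma lucas_u_eq_iff: "A \<ge> 2 \<Longrightarrow> lucas_u A m = lucas_u A n \<longleftrightarrow> m = n"
  by (simp add: lucas_u_strict_mono strict_mono_eq)

lemma lucas_u_ge_index: "A \<ge> 2 \<Longrightarrow> int n \<le> lucas_u A n"
proof (induction n)
  case (Suc n)
  then show ?case using lucas_u_growth[of A n] by simp
qed simp

lemma lucas_u_lower: "A \<ge> 2 \<Longrightarrow> (A - 1) ^ n \<le> lucas_u A (Suc n)"
proof (induction n)
  case (Suc n)
  then have "(A - 1) * (A - 1) ^ n \<le> (A - 1) * lucas_u A (Suc n)"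
    by (intro mult_left_mono) auto
  also have "\<dots> \<le> lucas_u A (Suc (Suc n))"
    using lucas_u_growth Suc.prems by blast
  finally show ?case by simp
qed simp

lemma lucas_u_upper: "A \<ge> 2 \<Longrightarrow> lucas_u A (Suc n) \<le> A ^ n"
proof (induction n)
  case (Suc n)
  have "lucas_u A (Suc (Suc n)) \<le> A * lucas_u A (Suc n)"
    using lucas_u_nonneg Suc.prems by simp
  also have "\<dots> \<le> A * A ^ n"
    using Suc by (intro mult_left_mono) auto
  finally show ?case by simp
qed simp

text \<open>The parameters used later may be negative, since \<open>U\<close> may be. Negating the
  parameter changes only signs of terms, so sizes can be read off for
  \<open>\<bar>A\<bar>\<close>.\<close>

lemma abs_lucas_u:
  assumes "\<bar>A\<bar> \<ge> 2"
  shows "\<bar>lucas_u A n\<bar> = lucas_u \<bar>A\<bar> n"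
proof (cases n)
  case (Suc k)
  show ?thesis
  proof (cases "A \<ge> 0")
    case True
    with assms show ?thesis using lucas_u_nonneg[of A n] by simp
  next
    case False
    then have "lucas_u A n = (- 1) ^ k * lucas_u \<bar>A\<bar> n"
      using lucas_u_minus[of "- A" k] Suc by simp
    then show ?thesis
      using assms lucas_u_nonneg[of "\<bar>A\<bar>" n] by (simp add: abs_mult power_abs)
  qed
qed simp

lemma sgn_lucas_u:
  assumes "\<bar>A\<bar> \<ge> 2"
  shows "sgn (lucas_u A (Suc n)) = sgn A ^ n"
proof (cases "A \<ge> 0")
  case True
  then show ?thesis
    using assms lucas_u_growth[of A n] by simp
next
  case False
  then have "lucas_u A (Suc n) = (- 1) ^ n * lucas_u (- A) (Suc n)"
    using lucas_u_minus[of "- A" n] by simp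
  moreover have "lucas_u (- A) (Suc n) > 0"
    using False assms lucas_u_growth[of "- A" n] by simp
  ultimately show ?thesis
    using False by (cases "even n") (simp_all add: sgn_mult)
qed

text \<open>The term with index \<open>n\<close> is an integer polynomial in the parameter. The case
  \<open>A' = 2\<close>, where the sequence is the identity, links terms with their indices.\<close>

lemma lucas_u_cong: "[lucas_u A n = lucas_u A' n] (mod (A - A'))"
proof -
  have "A - A' dvd lucas_u A n - lucas_u A' n"
  proof (induction n rule: less_induct)
    case (less n)
    show ?case
    proof (cases "n < 2")
      case True
      then have "n = 0 \<or> n = Suc 0" by auto
      then show ?thesis by auto
    next
      case False
      then obtain k where k: "n = Suc (Suc k)"
        by (metis add_2_eq_Suc le_add_diff_inverse not_less)
      have eq: "lucas_u A n - lucas_u A' n = (A - A') * lucas_u A (Suc k)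
          + A' * (lucas_u A (Suc k) - lucas_u A' (Suc k)) - (lucas_u A k - lucas_u A' k)"
        by (simp add: k algebra_simps)
      show ?thesis
        unfolding eq using less.IH k
        by (intro dvd_diff[OF dvd_add[OF dvd_triv_left dvd_mult]]) auto
    qed
  qed
  then show ?thesis by (simp add: cong_iff_dvd_diff)
qed

lemma lucas_u_2: "lucas_u 2 n = int n"
proof -
  have "lucas_u A n = int n" if "A = 2" for A
    using that by (induction A n rule: lucas_u.induct) auto
  then show ?thesis by simp
qed

lemma lucas_u_cong_index: "[lucas_u A n = int n] (mod (A - 2))"
  using lucas_u_cong[of A n 2] by (simp add: lucas_u_2)

text \<open>Descent: a solution \<open>(c, y)\<close> with \<open>c > 0\<close> is replaced by the
  smaller solution \<open>(A * c - y, c)\<close>, until \<open>(0, 1)\<close> is reached.\<close>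

lemma lucas_pairs_complete:
  assumes "A \<ge> 2"
  shows "0 \<le> c \<Longrightarrow> c < y \<Longrightarrow> y\<^sup>2 - A * y * c + c\<^sup>2 = 1
    \<Longrightarrow> \<exists>n. c = lucas_u A n \<and> y = lucas_u A (Suc n)"
proof (induction "nat y" arbitrary: y c rule: less_induct)
  case less
  show ?case
  proof (cases "c = 0")
    case True
    with less.prems have "y = 1"
      by (simp add: power2_eq_1_iff)
    then show ?thesis using True by (intro exI[of _ 0]) simp
  next
    case False
    \<comment> \<open>By Vieta, \<open>y\<close> and \<open>d\<close> are the two roots of
      \<open>t\<^sup>2 - A * c * t + c\<^sup>2 - 1\<close>; their product gives
      \<open>0 \<le> d < c\<close>.\<close>
    define d where "d = A * c - y"
    have eq: "y * d = c\<^sup>2 - 1"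
      using less.prems(3) by (simp add: d_def power2_eq_square algebra_simps)
    have "c\<^sup>2 \<ge> 1" using False less.prems(1)
      by (simp add: int_one_le_iff_zero_less)
    then have "d \<ge> 0"
      using eq less.prems(1,2) by (smt (verit) mult_pos_neg)
    have "y * d < y * c"
      using eq less.prems(1,2) by (smt (verit) mult_right_mono power2_eq_square)
    then have "d < c" using less.prems(1,2) by simp
    have "c\<^sup>2 - A * c * d + d\<^sup>2 = 1"
      using less.prems(3) by (simp add: d_def power2_eq_square algebra_simps)
    then obtain n where "d = lucas_u A n" "c = lucas_u A (Suc n)"
      using less.hyps[of c d] \<open>d \<ge> 0\<close> \<open>d < c\<close> less.prems by auto
    then show ?thesis
      by (intro exI[of _ "Suc n"]) (simp add: d_def)
  qed
qed

text \<open>Putting \<open>z = a * s - 2 * c\<close> turns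
  \<open>z\<^sup>2 = (a\<^sup>2 - 4) * s\<^sup>2 + 4\<close> into the form for neighbouring terms.
  Parity makes \<open>c\<close> an integer, and \<open>(a - 2) * s < z \<le> a * s\<close> places it
  in the range of the descent.\<close>

lemma lucas_pell_complete:
  assumes A: "\<bar>A\<bar> > 2" and sq: "is_square ((A\<^sup>2 - 4) * y\<^sup>2 + 4)"
  obtains n where "\<bar>y\<bar> = \<bar>lucas_u A n\<bar>"
proof (cases "y = 0")
  case True
  then show ?thesis using that[of 0] by simp
next
  case False
  define a where "a = \<bar>A\<bar>"
  define s where "s = \<bar>y\<bar>"
  have as: "a > 2" "s \<ge> 1" using A False by (auto simp: a_def s_def)
  from sq obtain z' where z': "(A\<^sup>2 - 4) * y\<^sup>2 + 4 = z'\<^sup>2"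
    by (auto simp: is_nth_power_def)
  define z where "z = \<bar>z'\<bar>"
  have z: "z\<^sup>2 = (a\<^sup>2 - 4) * s\<^sup>2 + 4" "z \<ge> 0"
    using z' by (auto simp: z_def a_def s_def)
  have zas: "z\<^sup>2 = (a * s)\<^sup>2 + 2 * (2 - 2 * s\<^sup>2)"
    unfolding z(1) by (simp add: power2_eq_square algebra_simps)
  have "even (z\<^sup>2) \<longleftrightarrow> even ((a * s)\<^sup>2)"
    unfolding zas by (rule dvd_add_left_iff[OF dvd_triv_left])
  then have "even (a * s - z)" by simp
  then obtain c where c: "a * s - z = 2 * c" by blast
  have zc: "z = a * s - 2 * c" using c by simp
  have s2: "s\<^sup>2 \<ge> 1" using as by (simp add: int_one_le_iff_zero_less)
  have "z\<^sup>2 \<le> (a * s)\<^sup>2"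
    using s2 by (simp add: z(1) algebra_simps)
  then have "z \<le> a * s" by (rule power2_le_imp_le) (use as in simp)
  then have "c \<ge> 0" using c by simp
  have "((a - 2) * s)\<^sup>2 < z\<^sup>2"
  proof -
    have "z\<^sup>2 - ((a - 2) * s)\<^sup>2 = (4 * a - 8) * s\<^sup>2 + 4"
      unfolding z(1) by (simp add: power2_eq_square algebra_simps)
    also have "\<dots> > 0" using as s2 by (smt (verit) mult_nonneg_nonneg)
    finally show ?thesis by simp
  qed
  then have "(a - 2) * s < z" using z(2) by (rule power_less_imp_less_base)
  then have "c < s" using c by (simp add: algebra_simps)
  have "4 * (s\<^sup>2 - a * s * c + c\<^sup>2) = 4"
    using z(1) unfolding zc by (simp add: power2_eq_square algebra_simps)
  then have "s\<^sup>2 - a * s * c + c\<^sup>2 = 1" by simp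
  then obtain n where "s = lucas_u a (Suc n)"
    using lucas_pairs_complete[of a c s] \<open>c \<ge> 0\<close> \<open>c < s\<close> as by auto
  then show ?thesis
    using that[of "Suc n"] abs_lucas_u[of A "Suc n"] A by (simp add: a_def s_def)
qed

section \<open>Divisibility and periodicity\<close>

lemma coprime_lucas_u_Suc: "coprime (lucas_u A n) (lucas_u A (Suc n))"
proof (rule coprimeI)
  fix d assume "d dvd lucas_u A n" "d dvd lucas_u A (Suc n)"
  then have "d dvd (lucas_u A (Suc n))\<^sup>2 - A * lucas_u A (Suc n) * lucas_u A n + (lucas_u A n)\<^sup>2"
    by (simp add: power2_eq_square)
  then show "is_unit d" by (simp only: lucas_u_invariant)
qed

text \<open>Modulo \<open>lucas_u A m\<close>, adding \<open>m\<close> to the index multiplies the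
  term by \<open>lucas_u A (Suc m)\<close>, which is a unit.\<close>

lemma lucas_u_dvd_add_iff:
  "lucas_u A m dvd lucas_u A (m + n) \<longleftrightarrow> lucas_u A m dvd lucas_u A n"
proof -
  have "lucas_u A (m + n) = lucas_u A (Suc m) * lucas_u A n
      + lucas_u A m * (lucas_u A (Suc n) - A * lucas_u A n)"
    by (simp add: lucas_u_add algebra_simps)
  then have "lucas_u A m dvd lucas_u A (m + n) \<longleftrightarrow> lucas_u A m dvd lucas_u A (Suc m) * lucas_u A n"
    by (metis dvd_add_left_iff dvd_triv_left)
  then show ?thesis
    by (simp add: coprime_dvd_mult_right_iff coprime_lucas_u_Suc)
qed

lemma lucas_u_dvd_imp_dvd:
  assumes "A \<ge> 2" and "lucas_u A m dvd lucas_u A n"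
  shows "m dvd n"
  using assms(2)
proof (induction n rule: less_induct)
  case (less n)
  show ?case
  proof (cases "m \<le> n \<and> m > 0")
    case True
    then obtain k where "n = m + k" using le_Suc_ex by blast
    then show ?thesis
      using less True by (simp add: lucas_u_dvd_add_iff)
  next
    case False
    have "n = 0"
    proof (cases "m = 0")
      case True
      then show ?thesis using less.prems lucas_u_eq_iff[OF assms(1), of n 0] by simp
    next
      case m: False
      with False have "lucas_u A n < lucas_u A m" by (simp add: lucas_u_less_iff assms)
      then have "lucas_u A n = 0"
        using less.prems lucas_u_nonneg[OF assms(1)] by (meson linorder_not_less order_le_less zdvd_not_zless)
      then show ?thesis using lucas_u_eq_iff[OF assms(1), of n 0] by simp
    qed
    then show ?thesis by simp
  qed
qed

lemma lucas_u_mult_cong: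
  "[lucas_u A (Suc (m * q)) = lucas_u A (Suc m) ^ q] (mod lucas_u A m)"
proof (induction q)
  case (Suc q)
  have "[lucas_u A (Suc (m + m * q)) = lucas_u A (Suc m) * lucas_u A (Suc (m * q))] (mod lucas_u A m)"
    by (simp add: lucas_u_add_Suc cong_iff_dvd_diff)
  also have "[lucas_u A (Suc m) * lucas_u A (Suc (m * q))
      = lucas_u A (Suc m) * lucas_u A (Suc m) ^ q] (mod lucas_u A m)"
    using Suc by (rule cong_scalar_left)
  finally show ?case by simp
qed simp

lemma lucas_u_dvd_mult: "lucas_u A m dvd lucas_u A (m * q)"
  by (induction q) (simp_all add: lucas_u_dvd_add_iff)

text \<open>The expansion of the term with index \<open>m * q\<close> to first order in
  \<open>lucas_u A m\<close>. The extra factor \<open>lucas_u A (Suc m)\<close> on the left avoids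
  the exponent \<open>q - 1\<close>.\<close>

lemma lucas_u_mult_cong_square:
  "[lucas_u A (m * q) * lucas_u A (Suc m) = int q * lucas_u A m * lucas_u A (Suc m) ^ q]
    (mod (lucas_u A m)\<^sup>2)"
proof (induction q)
  case (Suc q)
  let ?a = "lucas_u A m" and ?b = "lucas_u A (Suc m)"
  obtain s where s: "lucas_u A (m * q) = ?a * s" using lucas_u_dvd_mult by blast
  obtain r where r: "lucas_u A (Suc (m * q)) = ?b ^ q + ?a * r"
    using lucas_u_mult_cong[of A m q] by (metis cong_iff_lin cong_sym)
  obtain e where e: "lucas_u A (m * q) * ?b = int q * ?a * ?b ^ q + ?a\<^sup>2 * e"
    using Suc by (metis cong_iff_lin cong_sym)
  have "lucas_u A (m + m * q) * ?b = ?b * (lucas_u A (m * q) * ?b)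
      + ?b * ?a * lucas_u A (Suc (m * q)) - A * ?a * ?b * lucas_u A (m * q)"
    by (simp add: lucas_u_add algebra_simps)
  also have "\<dots> = ?b * (int q * ?a * ?b ^ q + ?a\<^sup>2 * e) + ?b * ?a * (?b ^ q + ?a * r)
      - A * ?a * ?b * (?a * s)"
    by (simp only: e r) (simp add: s)
  also have "\<dots> = int (Suc q) * ?a * ?b ^ Suc q + ?a\<^sup>2 * (?b * e + ?b * r - A * ?b * s)"
    by (simp add: power2_eq_square algebra_simps)
  finally show ?case by (simp add: cong_iff_dvd_diff)
qed simp

text \<open>With \<open>n = m * q\<close>, the first-order expansion leaves
  \<open>lucas_u A m\<close> dividing \<open>q\<close> times a power of its coprime neighbour, hence
  dividing \<open>q\<close>.\<close>

lemma lucas_u_square_dvd: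
  assumes A: "A \<ge> 2" and "m > 0" and "(lucas_u A m)\<^sup>2 dvd lucas_u A n"
  shows "m dvd n" and "lucas_u A m dvd int n"
proof -
  let ?a = "lucas_u A m" and ?b = "lucas_u A (Suc m)"
  have "?a dvd lucas_u A n" using assms(3) by (metis dvd_mult_left power2_eq_square)
  then show "m dvd n" using A lucas_u_dvd_imp_dvd by blast
  then obtain q where q: "n = m * q" by blast
  have "?a\<^sup>2 dvd int q * ?a * ?b ^ q"
    using lucas_u_mult_cong_square[of A m q] assms(3) unfolding q
    by (meson cong_dvd_iff dvd_mult2)
  then have "?a * ?a dvd ?a * (int q * ?b ^ q)" by (simp add: power2_eq_square algebra_simps)
  moreover have "?a \<noteq> 0" using lucas_u_ge_index[OF A, of m] \<open>m > 0\<close> by simp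
  ultimately have "?a dvd int q * ?b ^ q" by simp
  then have "?a dvd int q"
    by (simp add: coprime_dvd_mult_left_iff coprime_lucas_u_Suc)
  then show "?a dvd int n" by (simp add: q)
qed

section \<open>The companion sequence \<open>2, A, A\<^sup>2 - 2, ...\<close> and the folding of
  indices modulo its terms\<close>

definition lucas_v :: "int \<Rightarrow> nat \<Rightarrow> int" where
  "lucas_v A n = 2 * lucas_u A (Suc n) - A * lucas_u A n"

lemma lucas_v_square: "(lucas_v A n)\<^sup>2 = (A\<^sup>2 - 4) * (lucas_u A n)\<^sup>2 + 4"
  using lucas_u_invariant[of A n] by (simp add: lucas_v_def power2_eq_square algebra_simps)

lemma lucas_v_ge: "A \<ge> 2 \<Longrightarrow> (A - 2) * lucas_u A n \<le> lucas_v A n"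
  using lucas_u_growth[of A n] by (simp add: lucas_v_def algebra_simps)

lemma lucas_u_double_add:
  shows lucas_u_shift: "lucas_u A (2 * m + n) + lucas_u A n = lucas_v A m * lucas_u A (m + n)"
    and lucas_u_reflect: "lucas_u A (2 * m + n) - lucas_u A n = lucas_v A (m + n) * lucas_u A m"
proof -
  define a a' b b' where ab: "a = lucas_u A m" "a' = lucas_u A (Suc m)"
    "b = lucas_u A n" "b' = lucas_u A (Suc n)"
  \<comment> \<open>Multiplying \<open>b\<close> by the invariant, which is 1, makes both claims
    polynomial identities in \<open>a, a', b, b'\<close>.\<close>
  have inv: "b * (a'\<^sup>2 - A * a' * a + a\<^sup>2) = b"
    using lucas_u_invariant[of A m] by (simp add: ab)
  have sums: "lucas_u A (m + n) = a' * b + a * b' - A * a * b"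
    "lucas_u A (Suc (m + n)) = a' * b' - a * b"
    by (simp_all add: ab lucas_u_add lucas_u_add_Suc)
  have double: "lucas_u A (2 * m + n) = a' * (a' * b + a * b' - A * a * b)
      + a * (a' * b' - a * b) - A * a * (a' * b + a * b' - A * a * b)"
    using lucas_u_add[of A m "m + n"] by (simp add: mult_2 add.assoc sums flip: ab)
  have "lucas_u A (2 * m + n) + b * (a'\<^sup>2 - A * a' * a + a\<^sup>2)
      = (2 * a' - A * a) * (a' * b + a * b' - A * a * b)"
    unfolding double by (simp add: power2_eq_square algebra_simps)
  then show "lucas_u A (2 * m + n) + lucas_u A n = lucas_v A m * lucas_u A (m + n)"
    unfolding lucas_v_def sums inv by (simp flip: ab)
  have "lucas_u A (2 * m + n) - b * (a'\<^sup>2 - A * a' * a + a\<^sup>2)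
      = (2 * (a' * b' - a * b) - A * (a' * b + a * b' - A * a * b)) * a"
    unfolding double by (simp add: power2_eq_square algebra_simps)
  then show "lucas_u A (2 * m + n) - lucas_u A n = lucas_v A (m + n) * lucas_u A m"
    unfolding lucas_v_def sums inv by (simp flip: ab)
qed

text \<open>Modulo \<open>lucas_v A n\<close>, shifting the index by \<open>2 * n\<close> negates
  the term and reflecting it at \<open>n\<close> preserves it, so every index folds into
  \<open>{0..n}\<close>. The signs for index and term are recorded independently.\<close>

lemma lucas_u_reduce:
  assumes "n > 0"
  obtains r where "r \<le> n" and "int (2 * n) dvd int t - int r \<or> int (2 * n) dvd int t + int r"
    and "lucas_v A n dvd lucas_u A t - lucas_u A r \<or> lucas_v A n dvd lucas_u A t + lucas_u A r"
proof -
  have "\<exists>r\<le>n. (int (2 * n) dvd int t - int r \<or> int (2 * n) dvd int t + int r) \<and>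
    (lucas_v A n dvd lucas_u A t - lucas_u A r \<or> lucas_v A n dvd lucas_u A t + lucas_u A r)"
  proof (induction t rule: less_induct)
    case (less t)
    consider "t \<le> n" | "n < t" "t \<le> 2 * n" | "2 * n < t" by linarith
    then show ?case
    proof cases
      case 1
      then show ?thesis by (intro exI[of _ t]) auto
    next
      case 2
      define d where "d = 2 * n - t"
      define j where "j = t - n"
      have eq: "t = 2 * j + d" "n = j + d" "int t + int d = int (2 * n)" using 2 by (auto simp: d_def j_def)
      have "lucas_v A n dvd lucas_u A t - lucas_u A d"
        unfolding eq(1,2) lucas_u_reflect by simp
      moreover have "d \<le> n" using eq(2) by simp
      moreover have "int (2 * n) dvd int t + int d" unfolding eq(3) by (rule dvd_refl)
      ultimately show ?thesis by blast
    next
      case 3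
      define k where "k = t - 2 * n"
      have eq: "t = 2 * n + k" "k < t" using 3 assms by (auto simp: k_def)
      have v: "lucas_v A n dvd lucas_u A t + lucas_u A k"
        using lucas_u_shift[of A n k] eq by simp
      obtain r where r: "r \<le> n" "int (2 * n) dvd int k - int r \<or> int (2 * n) dvd int k + int r"
        "lucas_v A n dvd lucas_u A k - lucas_u A r \<or> lucas_v A n dvd lucas_u A k + lucas_u A r"
        using less eq by blast
      have "int t - int r = int (2 * n) + (int k - int r)" "int t + int r = int (2 * n) + (int k + int r)"
        using eq by auto
      then have "int (2 * n) dvd int t - int r \<or> int (2 * n) dvd int t + int r"
        using r(2) by (metis dvd_add_triv_left_iff)
      moreover have "lucas_u A t - lucas_u A r = (lucas_u A t + lucas_u A k) - (lucas_u A k + lucas_u A r)"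
        "lucas_u A t + lucas_u A r = (lucas_u A t + lucas_u A k) - (lucas_u A k - lucas_u A r)" by auto
      then have "lucas_v A n dvd lucas_u A t - lucas_u A r \<or> lucas_v A n dvd lucas_u A t + lucas_u A r"
        using v r(3) by (metis dvd_diff)
      ultimately show ?thesis using r(1) by blast
    qed
  qed
  then show ?thesis using that by blast
qed

text \<open>Fold \<open>t\<close> to some \<open>r \<le> n\<close>. Half of
  \<open>lucas_v A n\<close> already exceeds the sum of any two terms with index at most
  \<open>n\<close>, so the congruence between the terms at \<open>r\<close> and \<open>m\<close> is
  an equality.\<close>

lemma lucas_u_step_down:
  assumes A: "A \<ge> 7" and n: "n > 0" "m \<le> n" and f: "lucas_v A n = 2 * f"
    and dvd: "f dvd lucas_u A t - lucas_u A m \<or> f dvd lucas_u A t + lucas_u A m"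
  shows "int (2 * n) dvd int t - int m \<or> int (2 * n) dvd int t + int m"
proof -
  have A2: "A \<ge> 2" using A by simp
  obtain r where r: "r \<le> n" "int (2 * n) dvd int t - int r \<or> int (2 * n) dvd int t + int r"
    "lucas_v A n dvd lucas_u A t - lucas_u A r \<or> lucas_v A n dvd lucas_u A t + lucas_u A r"
    using lucas_u_reduce[OF n(1)] by metis
  let ?m = "lucas_u A m" and ?r = "lucas_u A r" and ?t = "lucas_u A t"
  have "f dvd ?t - ?r \<or> f dvd ?t + ?r" using r(3) f by (metis dvd_mult_right)
  then have dv: "f dvd ?r - ?m \<or> f dvd ?r + ?m"
  proof (elim disjE)
    assume h: "f dvd ?t - ?r"
    from dvd show ?thesis
    proof
      assume "f dvd ?t - ?m"
      from dvd_diff[OF this h] show ?thesis by simp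
    next
      assume "f dvd ?t + ?m"
      from dvd_diff[OF this h] show ?thesis by (simp add: add.commute)
    qed
  next
    assume h: "f dvd ?t + ?r"
    from dvd show ?thesis
    proof
      assume "f dvd ?t - ?m"
      from dvd_diff[OF h this] show ?thesis by simp
    next
      assume "f dvd ?t + ?m"
      from dvd_diff[OF h this] show ?thesis by simp
    qed
  qed
  have un: "lucas_u A n > 0" using lucas_u_ge_index[OF A2, of n] n by simp
  \<comment> \<open>Here \<open>A \<ge> 7\<close> enters: \<open>2 * f\<close> must exceed four
    times \<open>lucas_u A n\<close>.\<close>
  have "5 * lucas_u A n \<le> (A - 2) * lucas_u A n" using A un by (intro mult_right_mono) auto
  also have "\<dots> \<le> 2 * f" using lucas_v_ge[OF A2] f by metis
  finally have fb: "2 * lucas_u A n < f" using un by simp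
  have "?r \<le> lucas_u A n" "?m \<le> lucas_u A n" "0 \<le> ?r" "0 \<le> ?m"
    using r n A2 by (simp_all add: lucas_u_le_iff lucas_u_nonneg)
  then have "\<bar>?r - ?m\<bar> < f" "\<bar>?r + ?m\<bar> < f" using fb by auto
  then have "?r - ?m = 0 \<or> ?r + ?m = 0"
    using dv by (meson dvd_imp_le_int linorder_not_less abs_ge_self order_le_less_trans)
  then have "?r = ?m" using \<open>0 \<le> ?r\<close> \<open>0 \<le> ?m\<close> by auto
  then have "r = m" using A2 by (simp add: lucas_u_eq_iff)
  then show ?thesis using r by simp
qed

section \<open>A relation forcing a term of prescribed index\<close>

lemma is_square_mult_coprime_intD:
  fixes a b :: int
  assumes "a > 0" "b > 0" "coprime a b" "is_square (a * b)"
  shows "is_square a" and "is_square b"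
proof -
  obtain m n where mn: "a = int m" "b = int n" "m > 0" "n > 0"
    using assms(1,2) zero_less_imp_eq_int by metis
  obtain z where "int (m * n) = z\<^sup>2" using assms(4) mn by (auto simp: is_nth_power_def)
  then have "int (m * n) = int ((nat \<bar>z\<bar>)\<^sup>2)" by simp
  then have "m * n = (nat \<bar>z\<bar>)\<^sup>2" by (simp only: of_nat_eq_iff)
  then have "is_square (m * n)" by (rule is_nth_powerI)
  moreover have "coprime m n" using assms(3) mn by simp
  ultimately have "is_square m" "is_square n"
    using mn(3,4) is_nth_power_mult_coprime_natD by blast+
  then show "is_square a" "is_square b"
    unfolding mn by (auto simp: is_nth_power_def)
qed

text \<open>The Pell equation gives terms only up to sign; this carries congruences over to them at
  the cost of a sign.\<close>

lemma dvd_diff_or_sum_of_abs_eq: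
  fixes a b c d :: int
  assumes "k dvd c - d" "\<bar>a\<bar> = \<bar>c\<bar>" "\<bar>b\<bar> = \<bar>d\<bar>"
  shows "k dvd a - b \<or> k dvd a + b"
proof -
  have "a = c \<or> a = - c" "b = d \<or> b = - d" using assms by (auto simp: abs_if split: if_splits)
  moreover have "k dvd d - c" using assms(1) by (simp add: dvd_diff_commute)
  ultimately show ?thesis using assms(1) by auto
qed

text \<open>Up to sign, \<open>C\<close>, \<open>4 * E\<close> and \<open>H\<close> are terms with
  indices \<open>m\<close>, \<open>n\<close> and \<open>t\<close>, for the parameters
  \<open>A\<close>, \<open>A\<close> and \<open>2 * G\<close>. Modulo \<open>F\<close> one has
  \<open>H = C\<close> and \<open>2 * G = A\<close>, so stepping down gives
  \<open>t = \<plusminus> m\<close> modulo \<open>2 * n\<close>, and hence modulo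
  \<open>2 * C\<close>, because \<open>C\<^sup>2\<close> divides \<open>4 * E\<close>. Modulo
  \<open>2 * C\<close> one has \<open>H = B\<close> and \<open>2 * G = 2\<close>, so
  \<open>B = \<plusminus> t\<close>. Thus \<open>B = \<plusminus> m\<close> modulo
  \<open>2 * C\<close>, and size forces \<open>B = m\<close>.\<close>

lemma lucas_u_relation:
  fixes A B C D E F G H I x y :: int
  assumes B: "B > 1" and AB: "2 * B + 2 < \<bar>A\<bar>" and CB: "A - 2 dvd C - B" and x: "x \<noteq> 0"
    and D: "D = (A\<^sup>2 - 4) * C\<^sup>2 + 4"
    and E: "E = C\<^sup>2 * D * x"
    and F: "F = 4 * (A\<^sup>2 - 4) * E\<^sup>2 + 1"
    and G: "G = 1 + C * D * F - 2 * (A + 2) * (A - 2)\<^sup>2 * E\<^sup>2"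
    and H: "H = C + B * F + (2 * y - 1) * C * F"
    and I: "I = (G\<^sup>2 - 1) * H\<^sup>2 + 1"
    and sq: "is_square (D * F * I)"
  shows "C = lucas_u A (nat B)"
proof -
  define a where "a = \<bar>A\<bar>"
  have a: "a \<ge> 7" "a \<ge> 2" "a\<^sup>2 = A\<^sup>2" using B AB by (auto simp: a_def)
  have A2: "\<bar>A\<bar> > 2" "\<bar>A\<bar> \<ge> 2" using B AB by auto
  have "7\<^sup>2 \<le> a\<^sup>2" using a(1) by (intro power_mono) auto
  then have A4: "A\<^sup>2 - 4 > 0" using a by simp
  have C0: "C \<noteq> 0"
  proof
    assume "C = 0"
    then have "\<bar>A - 2\<bar> \<le> \<bar>B\<bar>" using CB B by (intro dvd_imp_le_int) auto
    then show False using B AB by linarith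
  qed
  have D4: "D > 4" using A4 C0 by (simp add: D)
  have E0: "E \<noteq> 0" using C0 D4 x by (simp add: E)
  have F1: "F > 1" using A4 E0 by (simp add: F)
  have DE: "D dvd E" by (simp add: E)
  have GD: "D dvd G - 1" using DE by (simp add: G power2_eq_square)
  have "G \<noteq> 0" using GD D4 by auto
  then have "G\<^sup>2 \<ge> 1" by (simp add: int_one_le_iff_zero_less)
  then have "(G\<^sup>2 - 1) * H\<^sup>2 \<ge> 0" by (intro mult_nonneg_nonneg) auto
  then have I0: "I > 0" by (simp add: I)
  have FD: "D dvd F - 1" using DE by (simp add: F power2_eq_square)
  have "G\<^sup>2 - 1 = (G - 1) * (G + 1)" by (simp add: power2_eq_square algebra_simps)
  then have ID: "D dvd I - 1" using GD by (simp add: I)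
  have cop1: "coprime u v" if "u dvd v - 1" for u v :: int
  proof (rule coprimeI)
    fix c assume "c dvd u" "c dvd v"
    then have "c dvd v - (v - 1)" using that by (meson dvd_diff dvd_trans)
    then show "is_unit c" by simp
  qed
  have "coprime D F" "coprime D I" using cop1 FD ID by auto
  have FH: "F dvd H - C"
    by (simp add: H algebra_simps)
  \<comment> \<open>The last summand of \<open>G\<close> is chosen so that twice it equals
    \<open>(A - 2) * (F - 1)\<close>.\<close>
  have "2 * G - A = F * (2 * C * D) - (A - 2) * F"
    by (simp add: G F power2_eq_square algebra_simps)
  then have FG: "F dvd 2 * G - A" by simp
  have "4 * I - D = ((2 * G)\<^sup>2 - A\<^sup>2) * H\<^sup>2 + (A\<^sup>2 - 4) * (H\<^sup>2 - C\<^sup>2)"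
    by (simp add: I D power2_eq_square algebra_simps)
  also have "\<dots> = (2 * G - A) * ((2 * G + A) * H\<^sup>2) + (H - C) * ((A\<^sup>2 - 4) * (H + C))"
    by (simp add: power2_eq_square algebra_simps)
  finally have "F dvd 4 * I - D" using FH FG by simp
  have "coprime F I"
  proof (rule coprimeI)
    fix c assume c: "c dvd F" "c dvd I"
    then have "c dvd 4 * I - (4 * I - D)" using \<open>F dvd 4 * I - D\<close>
      by (meson dvd_diff dvd_mult dvd_trans)
    then have "c dvd D" by simp
    then show "is_unit c" using c(1) \<open>coprime D F\<close> coprime_common_divisor by blast
  qed
  have "is_square (D * F)" and sqI: "is_square I"
    using is_square_mult_coprime_intD[of "D * F" I] sq D4 F1 I0 \<open>coprime D I\<close> \<open>coprime F I\<close>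
    by auto
  then have sqD: "is_square D" and sqF: "is_square F"
    using is_square_mult_coprime_intD[of D F] D4 F1 \<open>coprime D F\<close> by auto
  obtain m where m: "\<bar>C\<bar> = lucas_u a m"
    using lucas_pell_complete[OF A2(1)] sqD abs_lucas_u[OF A2(2)] unfolding D a_def by metis
  obtain f where f: "F = f\<^sup>2" using sqF by (auto simp: is_nth_power_def)
  have "(A\<^sup>2 - 4) * (4 * E)\<^sup>2 + 4 = (2 * f)\<^sup>2"
    using f by (simp add: F power2_eq_square algebra_simps)
  then obtain n where n: "\<bar>4 * E\<bar> = lucas_u a n"
    using lucas_pell_complete[OF A2(1) is_nth_powerI] abs_lucas_u[OF A2(2)] unfolding a_def by metis
  have G1: "G - 1 = C * (D * F - 2 * (A + 2) * (A - 2)\<^sup>2 * C ^ 3 * D\<^sup>2 * x\<^sup>2)"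
    unfolding G E by (simp add: power2_eq_square power3_eq_cube algebra_simps)
  \<comment> \<open>Parity excludes \<open>G = 1\<close>: the cofactor of \<open>C\<close> in
    \<open>G - 1\<close> is \<open>D\<close> times an odd number. The Pell lemma for
    \<open>2 * G\<close> needs \<open>G\<close> to be neither 1 nor -1.\<close>
  have "odd F" by (simp add: F)
  have "D * F - 2 * (A + 2) * (A - 2)\<^sup>2 * C ^ 3 * D\<^sup>2 * x\<^sup>2
      = D * (F - 2 * ((A + 2) * (A - 2)\<^sup>2 * C ^ 3 * D * x\<^sup>2))"
    by (simp add: power2_eq_square algebra_simps)
  moreover have "F - 2 * ((A + 2) * (A - 2)\<^sup>2 * C ^ 3 * D * x\<^sup>2) \<noteq> 0"
    using \<open>odd F\<close> by (metis dvd_triv_left eq_iff_diff_eq_0)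
  ultimately have "G \<noteq> 1" using G1 C0 D4 by auto
  moreover have "G \<noteq> - 1" using GD D4 zdvd_imp_le[of D 2] by auto
  ultimately have "\<bar>2 * G\<bar> > 2" using \<open>G \<noteq> 0\<close> by auto
  moreover obtain i where "I = i\<^sup>2" using sqI by (auto simp: is_nth_power_def)
  then have "((2 * G)\<^sup>2 - 4) * H\<^sup>2 + 4 = (2 * i)\<^sup>2"
    by (simp add: I power2_eq_square algebra_simps)
  ultimately obtain t where t: "\<bar>H\<bar> = \<bar>lucas_u (2 * G) t\<bar>"
    using lucas_pell_complete is_nth_powerI by metis
  have m0: "m > 0" using m C0 by (cases m) auto
  have n0: "n > 0" using n E0 by (cases n) auto
  have "C\<^sup>2 dvd 4 * E" by (simp add: E)
  then have "(lucas_u a m)\<^sup>2 dvd lucas_u a n" unfolding m[symmetric] n[symmetric] by simp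
  note sqdvd = lucas_u_square_dvd[OF a(2) m0 this]
  have "m \<le> n" using sqdvd(1) n0 by (rule dvd_imp_le)
  have "C dvd int n" using sqdvd(2) m by (metis abs_dvd_iff)
  then have Cn: "2 * C dvd int (2 * n)" by simp
  have "(lucas_u a n)\<^sup>2 = 16 * E\<^sup>2" by (simp add: power_mult_distrib flip: n)
  then have "(lucas_v a n)\<^sup>2 = 4 * F" by (simp add: lucas_v_square F a(3))
  then have "(lucas_v a n)\<^sup>2 = (2 * f)\<^sup>2" by (simp add: f power_mult_distrib)
  then have "lucas_v a n = 2 * f \<or> lucas_v a n = - (2 * f)" by (simp only: power2_eq_iff)
  then have v: "lucas_v a n = 2 * f \<or> lucas_v a n = 2 * (- f)" by simp
  have "f dvd F" by (simp add: f)
  have "f dvd lucas_u A t - C \<or> f dvd lucas_u A t + C"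
  proof -
    have "2 * G - A dvd lucas_u (2 * G) t - lucas_u A t"
      using lucas_u_cong[of "2 * G" t A] by (simp add: cong_iff_dvd_diff)
    then have ft: "f dvd lucas_u (2 * G) t - lucas_u A t"
      using FG \<open>f dvd F\<close> dvd_trans by blast
    have fh: "f dvd H - C" using FH \<open>f dvd F\<close> dvd_trans by blast
    have "H = lucas_u (2 * G) t \<or> H = - lucas_u (2 * G) t" using t by (auto simp: abs_eq_iff)
    then show ?thesis
    proof
      assume "H = lucas_u (2 * G) t"
      then have "lucas_u A t - C = (H - C) - (lucas_u (2 * G) t - lucas_u A t)" by simp
      then show ?thesis using ft fh by (metis dvd_diff)
    next
      assume "H = - lucas_u (2 * G) t"
      then have "lucas_u A t + C = - (H - C) - (lucas_u (2 * G) t - lucas_u A t)" by simp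
      then show ?thesis using ft fh by (metis dvd_diff dvd_minus_iff)
    qed
  qed
  then have "f dvd lucas_u a t - lucas_u a m \<or> f dvd lucas_u a t + lucas_u a m"
  proof
    assume "f dvd lucas_u A t - C"
    then show ?thesis
      by (rule dvd_diff_or_sum_of_abs_eq) (use m a(2) lucas_u_nonneg abs_lucas_u[OF A2(2)] in \<open>auto simp: a_def\<close>)
  next
    assume "f dvd lucas_u A t + C"
    then have "f dvd lucas_u A t - (- C)" by simp
    then show ?thesis
      by (rule dvd_diff_or_sum_of_abs_eq) (use m a(2) lucas_u_nonneg abs_lucas_u[OF A2(2)] in \<open>auto simp: a_def\<close>)
  qed
  then have "int (2 * n) dvd int t - int m \<or> int (2 * n) dvd int t + int m"
    using v lucas_u_step_down[OF a(1) n0 \<open>m \<le> n\<close>, of f t] lucas_u_step_down[OF a(1) n0 \<open>m \<le> n\<close>, of "- f" t]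
    by auto
  then have tm: "2 * C dvd int t - int m \<or> 2 * C dvd int t + int m"
    using Cn dvd_trans by blast
  \<comment> \<open>As \<open>F = 1\<close> modulo \<open>2 * C\<close>, \<open>H\<close> reduces to
    \<open>C + B + (2 * y - 1) * C\<close>; the odd coefficient cancels the single
    \<open>C\<close>.\<close>
  have "H - B = C * (F - 1) + B * (F - 1) + 2 * C * (y * F - F) + 2 * C"
    by (simp add: H algebra_simps)
  moreover have "F - 1 = 2 * C * (2 * (A\<^sup>2 - 4) * C ^ 3 * D\<^sup>2 * x\<^sup>2)"
    by (simp add: F E power2_eq_square power3_eq_cube algebra_simps)
  ultimately have HB: "2 * C dvd H - B"
    by (metis dvd_add dvd_mult dvd_triv_left dvd_refl)
  have "2 * C dvd 2 * (G - 1)" using G1 by (simp add: mult_dvd_mono)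
  moreover have "2 * G - 2 dvd lucas_u (2 * G) t - int t"
    using lucas_u_cong_index[of "2 * G" t] by (simp add: cong_iff_dvd_diff)
  ultimately have "2 * C dvd lucas_u (2 * G) t - int t"
    by (metis dvd_trans right_diff_distrib mult.right_neutral)
  then have Ht: "2 * C dvd H - int t \<or> 2 * C dvd H + int t"
    by (rule dvd_diff_or_sum_of_abs_eq) (use t in auto)
  have Bm: "2 * C dvd B - int m \<or> 2 * C dvd B + int m"
  proof -
    have Bt: "2 * C dvd B - int t \<or> 2 * C dvd B + int t"
    proof (rule disj_forward[OF Ht])
      assume "2 * C dvd H - int t"
      from dvd_diff[OF this HB] show "2 * C dvd B - int t" by simp
    next
      assume "2 * C dvd H + int t"
      from dvd_diff[OF this HB] show "2 * C dvd B + int t" by (simp add: add.commute)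
    qed
    from Bt tm show ?thesis
    proof (elim disjE)
      assume h: "2 * C dvd B - int t" "2 * C dvd int t - int m"
      from dvd_add[OF h] show ?thesis by simp
    next
      assume h: "2 * C dvd B - int t" "2 * C dvd int t + int m"
      from dvd_add[OF h] show ?thesis by simp
    next
      assume h: "2 * C dvd B + int t" "2 * C dvd int t - int m"
      from dvd_diff[OF h] show ?thesis by simp
    next
      assume h: "2 * C dvd B + int t" "2 * C dvd int t + int m"
      from dvd_diff[OF h] show ?thesis by simp
    qed
  qed
  \<comment> \<open>Excluding \<open>m = 1\<close> gives \<open>\<bar>C\<bar> \<ge> a > B\<close>,
    so that \<open>B\<close> and \<open>m\<close> are determined by their residues up to sign modulo
    \<open>2 * C\<close>.\<close>
  have "m \<noteq> 1"
  proof
    assume "m = 1"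
    then have "\<bar>C\<bar> = 1" using m by simp
    then have "C - B \<noteq> 0" "\<bar>C - B\<bar> \<le> B + 1" using B by auto
    then have "\<bar>A - 2\<bar> \<le> B + 1" using CB dvd_imp_le_int order_trans by blast
    then show False using AB B by linarith
  qed
  then have "2 \<le> m" using m0 by simp
  then have "lucas_u a 2 \<le> \<bar>C\<bar>" using a(2) m by (simp add: lucas_u_le_iff)
  then have Ca: "a \<le> \<bar>C\<bar>" by (simp add: numeral_2_eq_2)
  have "int m \<le> \<bar>C\<bar>" using lucas_u_ge_index[OF a(2)] m by simp
  then have "\<bar>B - int m\<bar> < \<bar>2 * C\<bar>" "\<bar>B + int m\<bar> < \<bar>2 * C\<bar>"
    using Ca B AB unfolding a_def by auto
  then have "B - int m = 0 \<or> B + int m = 0" using Bm by (meson dvd_imp_le_int linorder_not_less)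
  then have Bm: "B = int m" using B by auto
  then have "\<bar>C\<bar> = \<bar>lucas_u A m\<bar>" using m abs_lucas_u[OF A2(2)] by (simp add: a_def)
  then consider "C = lucas_u A m" | "C = - lucas_u A m" by (auto simp: abs_eq_iff)
  then show ?thesis
  proof cases
    case 1
    then show ?thesis by (simp add: Bm)
  next
    case 2
    \<comment> \<open>The wrong sign would make \<open>A - 2\<close> divide \<open>2 * B\<close>,
      which is too small.\<close>
    have "A - 2 dvd lucas_u A m - B"
      using lucas_u_cong_index[of A m] Bm by (simp add: cong_iff_dvd_diff)
    from dvd_add[OF CB this] have "A - 2 dvd 2 * B" using 2 by simp
    then have "\<bar>A - 2\<bar> \<le> 2 * B" using B dvd_imp_le_int[of "2 * B" "A - 2"] by simp
    then show ?thesis using AB B by linarith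
  qed
qed

section \<open>Quotients of terms of two sequences\<close>

text \<open>Bernoulli's inequality for \<open>(1 - 1 / a) ^ n\<close>, cleared of
  denominators.\<close>

lemma power_pred_lower:
  fixes a :: int
  assumes "a \<ge> 1"
  shows "a ^ n * (a - int n) \<le> (a - 1) ^ n * a"
proof (induction n)
  case (Suc n)
  have "a ^ Suc n * (a - int (Suc n)) \<le> a ^ Suc n * (a - int (Suc n)) + a ^ n * int n"
    using assms by simp
  also have "\<dots> = (a - 1) * (a ^ n * (a - int n))"
    by (simp add: algebra_simps)
  also have "\<dots> \<le> (a - 1) * ((a - 1) ^ n * a)"
    using assms Suc by (intro mult_left_mono) auto
  finally show ?case by (simp add: mult.assoc)
qed simp

lemma abs_lucas_u_lower: "\<bar>A\<bar> \<ge> 2 \<Longrightarrow> (\<bar>A\<bar> - 1) ^ n \<le> \<bar>lucas_u A (Suc n)\<bar>"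
  by (metis abs_lucas_u lucas_u_lower)

lemma abs_lucas_u_upper: "\<bar>A\<bar> \<ge> 2 \<Longrightarrow> \<bar>lucas_u A (Suc n)\<bar> \<le> \<bar>A\<bar> ^ n"
  by (metis abs_lucas_u lucas_u_upper)

text \<open>Modulo \<open>M - 2\<close> the index \<open>s\<close> of \<open>K\<close> agrees with
  \<open>j\<close> up to sign, so it is \<open>j\<close> itself or at least about
  \<open>\<bar>M\<bar>\<close>.\<close>

lemma lucas_u_index_cases:
  assumes M: "\<bar>M\<bar> > 2 * int j + 2" and "j > 0"
    and sq: "is_square ((M\<^sup>2 - 4) * K\<^sup>2 + 4)" and K: "M - 2 dvd K - int j"
  shows "K = lucas_u M j \<or> (\<exists>s. \<bar>K\<bar> = lucas_u \<bar>M\<bar> s \<and> \<bar>M\<bar> \<le> int s + int j + 2)"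
proof -
  have M2: "\<bar>M\<bar> > 2" "\<bar>M\<bar> \<ge> 2" using M by auto
  obtain s where s: "\<bar>K\<bar> = \<bar>lucas_u M s\<bar>"
    using lucas_pell_complete[OF M2(1) sq] .
  have us: "M - 2 dvd lucas_u M i - int i" for i
    using lucas_u_cong_index[of M i] by (simp add: cong_iff_dvd_diff)
  have js: "M - 2 dvd int s - int j \<or> M - 2 dvd int s + int j"
  proof -
    have "M - 2 dvd K - int s \<or> M - 2 dvd K + int s"
      by (rule dvd_diff_or_sum_of_abs_eq[OF us[of s]]) (use s in auto)
    then show ?thesis
    proof
      assume "M - 2 dvd K - int s"
      from dvd_diff[OF K this] show ?thesis by simp
    next
      assume "M - 2 dvd K + int s"
      from dvd_diff[OF this K] show ?thesis by (simp add: add.commute)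
    qed
  qed
  show ?thesis
  proof (cases "s = j")
    case True
    have "K \<noteq> - lucas_u M j"
    proof
      assume "K = - lucas_u M j"
      then have "M - 2 dvd 2 * int j"
        using dvd_add[OF K us[of j]] by simp
      then have "\<bar>M - 2\<bar> \<le> 2 * int j"
        using dvd_imp_le_int[of "2 * int j" "M - 2"] \<open>j > 0\<close> by simp
      then show False using M by linarith
    qed
    then show ?thesis using s True by (auto simp: abs_eq_iff)
  next
    case False
    have "\<bar>M - 2\<bar> \<le> int s + int j"
      using js
    proof
      assume "M - 2 dvd int s - int j"
      then have "\<bar>M - 2\<bar> \<le> \<bar>int s - int j\<bar>" using False by (intro dvd_imp_le_int) auto
      then show ?thesis by linarith
    next
      assume "M - 2 dvd int s + int j"
      then have "\<bar>M - 2\<bar> \<le> \<bar>int s + int j\<bar>" using \<open>j > 0\<close> by (intro dvd_imp_le_int) auto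
      then show ?thesis by linarith
    qed
    then have "\<bar>M\<bar> \<le> int s + int j + 2" by linarith
    then show ?thesis using s abs_lucas_u[OF M2(2)] by auto
  qed
qed

text \<open>With any other index \<open>\<bar>K\<bar>\<close> is at least
  \<open>2 * \<bar>C\<bar>\<close>, and then no nonzero multiple of \<open>K\<close> lies within
  \<open>\<bar>K\<bar> / 2\<close> of \<open>C\<close>.\<close>

lemma lucas_u_quotient_index:
  assumes A: "\<bar>A\<bar> \<ge> 2" and AM: "\<bar>A\<bar> + 2 \<le> \<bar>M\<bar>" and mM: "int (m + q) + 5 \<le> \<bar>M\<bar>" and "q \<le> m"
    and C: "C = lucas_u A (Suc m)"
    and sq: "is_square ((M\<^sup>2 - 4) * K\<^sup>2 + 4)" and K: "M - 2 dvd K - int (Suc q)"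
    and "L \<noteq> 0" and CK: "2 * \<bar>C - K * L\<bar> < \<bar>K\<bar>"
  shows "K = lucas_u M (Suc q)"
proof (rule ccontr)
  assume "K \<noteq> lucas_u M (Suc q)"
  moreover have "\<bar>M\<bar> > 2 * int (Suc q) + 2" using mM \<open>q \<le> m\<close> by simp
  ultimately obtain s where s: "\<bar>K\<bar> = lucas_u \<bar>M\<bar> s" "\<bar>M\<bar> \<le> int s + int (Suc q) + 2"
    using lucas_u_index_cases sq K by blast
  have M2: "\<bar>M\<bar> \<ge> 2" using A AM by simp
  have "Suc (Suc m) \<le> s" using s(2) mM by linarith
  have "2 * \<bar>C\<bar> \<le> 2 * \<bar>A\<bar> ^ m" unfolding C using abs_lucas_u_upper[OF A] by simp
  also have "\<dots> \<le> (\<bar>M\<bar> - 1) * (\<bar>M\<bar> - 1) ^ m"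
    using A AM by (intro mult_mono power_mono) auto
  also have "\<dots> \<le> lucas_u \<bar>M\<bar> (Suc (Suc m))" using lucas_u_lower[OF M2, of "Suc m"] by simp
  also have "\<dots> \<le> \<bar>K\<bar>" unfolding s(1) using M2 \<open>Suc (Suc m) \<le> s\<close> by (simp only: lucas_u_le_iff)
  finally have "2 * \<bar>C\<bar> \<le> \<bar>K\<bar>" .
  moreover have "\<bar>K\<bar> * 1 \<le> \<bar>K\<bar> * \<bar>L\<bar>" using \<open>L \<noteq> 0\<close> by (intro mult_left_mono) auto
  then have "\<bar>K\<bar> \<le> \<bar>K * L\<bar>" by (simp add: abs_mult)
  moreover have "\<bar>K * L\<bar> \<le> \<bar>C\<bar> + \<bar>C - K * L\<bar>"
    using abs_triangle_ineq2[of "K * L" C] by (simp add: abs_minus_commute)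
  ultimately show False using CK by (smt (verit))
qed

text \<open>\<open>C\<close> is at least half of \<open>A ^ (P * X)\<close> in size and
  \<open>K\<close> at most \<open>M ^ (Q * X)\<close>. Both powers contain the same factor
  \<open>U ^ (P * Q * X)\<close>, which cancels.\<close>

lemma lucas_u_quotient_bound:
  assumes A: "A = U ^ Q * (V + 1)" and M: "M = U ^ P * V" and "U \<noteq> 0"
    and A2: "\<bar>A\<bar> \<ge> 2" "\<bar>A\<bar> \<ge> 2 * int (P * X)" and M2: "\<bar>M\<bar> \<ge> 2"
    and C: "C = lucas_u A (Suc (P * X))" and K: "K = lucas_u M (Suc (Q * X))"
    and CK: "2 * \<bar>C - K * L\<bar> < \<bar>K\<bar>"
  shows "\<bar>V + 1\<bar> ^ (P * X) < \<bar>V\<bar> ^ (Q * X) * (2 * \<bar>L\<bar> + 1)"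
proof -
  let ?a = "\<bar>A\<bar>" and ?m = "P * X" and ?q = "Q * X"
  have "?a ^ ?m * ?a \<le> ?a ^ ?m * (2 * (?a - int ?m))"
    using A2 by (intro mult_left_mono) auto
  also have "\<dots> = 2 * (?a ^ ?m * (?a - int ?m))"
    by (rule mult.left_commute)
  also have "\<dots> \<le> 2 * ((?a - 1) ^ ?m * ?a)"
    using A2 by (intro mult_left_mono power_pred_lower) auto
  also have "\<dots> = (2 * (?a - 1) ^ ?m) * ?a"
    by simp
  finally have "?a ^ ?m \<le> 2 * (?a - 1) ^ ?m"
    by (rule mult_right_le_imp_le) (use A2 in auto)
  also have "\<dots> \<le> 2 * \<bar>C\<bar>" unfolding C using abs_lucas_u_lower[OF A2(1)] by simp
  also have "2 * \<bar>C\<bar> < \<bar>K\<bar> * (2 * \<bar>L\<bar> + 1)"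
    using CK abs_triangle_ineq2[of C "K * L"] by (simp add: abs_mult algebra_simps)
  also have "\<dots> \<le> \<bar>M\<bar> ^ ?q * (2 * \<bar>L\<bar> + 1)"
    unfolding K using abs_lucas_u_upper[OF M2] by (intro mult_right_mono) auto
  finally have "\<bar>U\<bar> ^ (P * Q * X) * \<bar>V + 1\<bar> ^ ?m < \<bar>U\<bar> ^ (P * Q * X) * (\<bar>V\<bar> ^ ?q * (2 * \<bar>L\<bar> + 1))"
    by (simp add: A M abs_mult power_abs power_mult_distrib ac_simps flip: power_mult)
  then show ?thesis using \<open>U \<noteq> 0\<close> by simp
qed

text \<open>Bernoulli and \<open>Q + 1 \<le> P\<close> give
  \<open>v ^ Q * (v - P) \<le> (v - 1) ^ P\<close>; the power with exponent \<open>X\<close> is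
  compared with the bound.\<close>

lemma power_quotient_lower:
  fixes v :: int
  assumes "Q < P" and v: "v > int P" and bd: "(v - 1) ^ (P * X) < v ^ (Q * X) * (2 * l + 1)"
  shows "(v - int P) ^ X \<le> 2 * l"
proof -
  have "v ^ Q * (v - int P) * v = v ^ Suc Q * (v - int P)" by simp
  also have "\<dots> \<le> v ^ P * (v - int P)"
    using assms by (intro mult_right_mono power_increasing) auto
  also have "\<dots> \<le> (v - 1) ^ P * v" using v by (intro power_pred_lower) auto
  finally have "v ^ Q * (v - int P) \<le> (v - 1) ^ P"
    by (rule mult_right_le_imp_le) (use v in auto)
  then have "(v ^ Q * (v - int P)) ^ X \<le> ((v - 1) ^ P) ^ X"
    using v by (intro power_mono) auto
  then have "v ^ (Q * X) * (v - int P) ^ X < v ^ (Q * X) * (2 * l + 1)"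
    using bd by (simp add: power_mult power_mult_distrib)
  then have "(v - int P) ^ X < 2 * l + 1"
    using v by (simp add: mult_less_cancel_left_pos)
  then show ?thesis by simp
qed

section \<open>Detecting powers\<close>

text \<open>This is \<open>(p ^ n - p ^ (- n)) / (p - p ^ (- 1))\<close>, the closed form for the
  roots \<open>p\<close> and \<open>1 / p\<close>, cleared of denominators. Modulo the divisor,
  \<open>p ^ n * lucas_u A n\<close> obeys a recurrence with roots \<open>p\<^sup>2\<close> and
  1.\<close>

lemma lucas_u_power_cong:
  fixes p :: int
  shows "p * A - p\<^sup>2 - 1 dvd (p\<^sup>2 - 1) * p ^ n * lucas_u A n - p * (p ^ (2 * n) - 1)"
proof (induction n rule: less_induct)
  case (less n)
  consider "n = 0" | "n = Suc 0" | k where "n = Suc (Suc k)"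
    by (metis not0_implies_Suc)
  then show ?case
  proof cases
    case 3
    let ?f = "\<lambda>n. (p\<^sup>2 - 1) * p ^ n * lucas_u A n - p * (p ^ (2 * n) - 1)"
    have "?f n = (p * A - p\<^sup>2 - 1) * ((p\<^sup>2 - 1) * p ^ Suc k * lucas_u A (Suc k))
       + (p\<^sup>2 + 1) * ?f (Suc k) - p\<^sup>2 * ?f k"
      by (simp add: 3 power2_eq_square algebra_simps)
    then show ?thesis
      using less[of "Suc k"] less[of k] 3 by (metis dvd_add dvd_diff dvd_mult dvd_triv_left lessI less_SucI)
  qed (simp_all add: power2_eq_square)
qed

text \<open>Eliminating \<open>C\<close> between the hypothesis and the closed form leaves
  \<open>- p\<close> times the product; the modulus is -1 modulo \<open>p\<close>, so
  \<open>p\<close> can be cancelled.\<close>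

lemma lucas_u_power_factor_dvd:
  fixes p A W :: int
  assumes C: "C = lucas_u A n"
    and dvd: "p * A - p\<^sup>2 - 1 dvd (p\<^sup>2 - 1) * W * C - p * (W\<^sup>2 - 1)"
  shows "p * A - p\<^sup>2 - 1 dvd (W - p ^ n) * (p ^ n * W + 1)"
proof -
  let ?N = "p * A - p\<^sup>2 - 1"
  have "?N dvd p ^ n * ((p\<^sup>2 - 1) * W * C - p * (W\<^sup>2 - 1))
      - W * ((p\<^sup>2 - 1) * p ^ n * lucas_u A n - p * (p ^ (2 * n) - 1))"
    by (rule dvd_diff[OF dvd_mult[OF dvd] dvd_mult[OF lucas_u_power_cong]])
  also have "\<dots> = - p * ((W - p ^ n) * (p ^ n * W + 1))"
    unfolding C by (simp add: power2_eq_square power_mult power_mult_distrib algebra_simps)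
  finally have "?N dvd p * ((W - p ^ n) * (p ^ n * W + 1))" by simp
  moreover have "coprime ?N p"
  proof (rule coprimeI)
    fix c assume "c dvd ?N" "c dvd p"
    then have "c dvd p * (A - p) - ?N" by (meson dvd_diff dvd_mult2)
    then show "is_unit c" by (simp add: power2_eq_square algebra_simps)
  qed
  ultimately show ?thesis by (simp add: coprime_dvd_mult_right_iff)
qed

lemma power_unique_solution:
  fixes p A W z :: int
  assumes p: "p \<ge> 2" and "P \<ge> 2" "X \<ge> 3" and z: "z \<ge> p ^ (4 * P)" and W: "1 \<le> \<bar>W\<bar>" "\<bar>W\<bar> \<le> z"
    and A: "\<bar>A\<bar> \<ge> 3 * z ^ Suc X"
    and dvd: "p * A - p\<^sup>2 - 1 dvd (W - p ^ Suc (P * X)) * (p ^ Suc (P * X) * W + 1)"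
  shows "W = p ^ Suc (P * X)"
proof -
  define r where "r = p ^ Suc (P * X)"
  have r: "r > p" unfolding r_def using power_strict_increasing[of 1 "Suc (P * X)" p] assms by simp
  have z1: "z \<ge> 1" using W by simp
  \<comment> \<open>The exponent \<open>4 * P\<close> in the bound on \<open>z\<close> and
    \<open>X \<ge> 3\<close> give \<open>r\<^sup>2 \<le> z ^ (X - 1)\<close>; the two remaining
    factors \<open>z\<close> absorb \<open>W\<^sup>2\<close>.\<close>
  have "P * 1 \<le> P * (X - 2)" using assms by (intro mult_left_mono) auto
  then have "2 * Suc (P * X) \<le> 4 * P * (X - 1)"
    using assms by (simp add: algebra_simps diff_mult_distrib2)
  then have "r\<^sup>2 \<le> (p ^ (4 * P)) ^ (X - 1)"
    unfolding r_def power_mult[symmetric] using p by (intro power_increasing) (auto simp: algebra_simps)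
  also have "\<dots> \<le> z ^ (X - 1)" using z p by (intro power_mono) auto
  finally have "r\<^sup>2 * W\<^sup>2 \<le> z ^ (X - 1) * z\<^sup>2"
    using W z1 by (intro mult_mono) (auto simp: abs_le_square_iff[symmetric])
  also have "\<dots> = z ^ Suc X" using assms(3) by (simp flip: power_add)
  finally have rW: "r\<^sup>2 * W\<^sup>2 \<le> z ^ Suc X" .
  have "1 \<le> W\<^sup>2" using W by (metis one_le_power power2_abs)
  then have "r\<^sup>2 * 1 \<le> r\<^sup>2 * W\<^sup>2" by (intro mult_left_mono) auto
  moreover have "p\<^sup>2 < r\<^sup>2" using r p by (intro power_strict_mono) auto
  ultimately have pz: "p\<^sup>2 + 1 \<le> z ^ Suc X" "0 < r\<^sup>2 * W\<^sup>2"
    using rW zero_le_power2[of p] by linarith+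
  have "1 * 1 \<le> r * \<bar>W\<bar>" "1 * \<bar>W\<bar> \<le> r * \<bar>W\<bar>" "r * 1 \<le> r * \<bar>W\<bar>"
    using r p W by (intro mult_mono; simp)+
  then have le: "\<bar>W\<bar> + r \<le> 2 * (r * \<bar>W\<bar>)" "r * \<bar>W\<bar> + 1 \<le> 2 * (r * \<bar>W\<bar>)" by auto
  have "\<bar>W - r\<bar> \<le> 2 * (r * \<bar>W\<bar>)" using le(1) r p by linarith
  moreover have "\<bar>r * W + 1\<bar> \<le> 2 * (r * \<bar>W\<bar>)"
    using le(2) r p abs_triangle_ineq[of "r * W" 1] by (simp add: abs_mult)
  ultimately have "\<bar>(W - r) * (r * W + 1)\<bar> \<le> (2 * (r * \<bar>W\<bar>)) * (2 * (r * \<bar>W\<bar>))"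
    unfolding abs_mult by (intro mult_mono) (use r p in auto)
  also have "\<dots> = 4 * (r\<^sup>2 * W\<^sup>2)" by (simp add: power2_eq_square algebra_simps)
  also have "\<dots> < 5 * z ^ Suc X" using rW pz by linarith
  also have "\<dots> \<le> 2 * (3 * z ^ Suc X) - p\<^sup>2 - 1" using pz by linarith
  also have "\<dots> \<le> p * \<bar>A\<bar> - p\<^sup>2 - 1"
    using mult_mono[of 2 p "3 * z ^ Suc X" "\<bar>A\<bar>"] A p z1 by simp
  also have "\<dots> = \<bar>p * A\<bar> - p\<^sup>2 - 1" using p by (simp add: abs_mult)
  also have "\<dots> \<le> \<bar>p * A - p\<^sup>2 - 1\<bar>" using zero_le_power2[of p] by linarith
  finally have "(W - r) * (r * W + 1) = 0"
    using dvd unfolding r_def[symmetric] by (meson dvd_imp_le_int linorder_not_less)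
  moreover have "r * W + 1 \<noteq> 0"
  proof
    assume "r * W + 1 = 0"
    then have "r dvd 1" by (metis add.commute add_diff_cancel_right' dvd_minus_iff dvd_triv_left diff_0 add.inverse_inverse)
    then show False using r p by simp
  qed
  ultimately show ?thesis by (simp add: r_def)
qed

section \<open>Binomial coefficients\<close>

text \<open>\<open>T\<close> is the polynomial part of \<open>(V + 1) ^ m / V ^ q\<close>, with the
  binomial coefficient as constant term, and \<open>R\<close> collects the monomials of degree below
  \<open>q\<close>.\<close>

lemma binomial_power_split:
  fixes V :: int
  assumes "V \<ge> 1" and "q \<le> m"
  obtains T R where "(V + 1) ^ m = T * V ^ q + R" "0 \<le> T" "0 \<le> R" "R * V \<le> 2 ^ m * V ^ q"
    "V dvd T - int (m choose q)"
proof -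
  define T where "T = (\<Sum>k=q..m. int (m choose k) * V ^ (k - q))"
  define R where "R = (\<Sum>k<q. int (m choose k) * V ^ k)"
  have "{..m} = {q..m} \<union> {..<q}" using assms by auto
  then have "(V + 1) ^ m = (\<Sum>k=q..m. int (m choose k) * V ^ k) + R"
    unfolding binomial_ring R_def by (subst sum.union_disjoint[symmetric]) auto
  also have "(\<Sum>k=q..m. int (m choose k) * V ^ k) = T * V ^ q"
    unfolding T_def sum_distrib_right by (intro sum.cong) (auto simp flip: power_add)
  finally have eq: "(V + 1) ^ m = T * V ^ q + R" .
  have "R * V \<le> (\<Sum>k<q. int (m choose k) * V ^ q)"
    unfolding R_def sum_distrib_right
  proof (rule sum_mono)
    fix k assume "k \<in> {..<q}"
    then have "V ^ Suc k \<le> V ^ q" using assms by (intro power_increasing) auto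
    then show "int (m choose k) * V ^ k * V \<le> int (m choose k) * V ^ q"
      using mult_left_mono[of "V ^ Suc k" "V ^ q" "int (m choose k)"] by (simp add: algebra_simps)
  qed
  also have "\<dots> \<le> (\<Sum>k\<le>m. int (m choose k) * V ^ q)"
    using assms by (intro sum_mono2) auto
  also have "\<dots> = 2 ^ m * V ^ q"
    using choose_row_sum[of m] by (metis of_nat_numeral of_nat_power of_nat_sum sum_distrib_right)
  finally have "R * V \<le> 2 ^ m * V ^ q" .
  moreover have "T - int (m choose q) = (\<Sum>k=Suc q..m. int (m choose k) * V ^ (k - q))"
    unfolding T_def using assms by (simp add: sum.atLeast_Suc_atMost)
  then have "V dvd T - int (m choose q)" by (auto intro!: dvd_sum dvd_mult dvd_power)
  moreover have "0 \<le> T" "0 \<le> R" unfolding T_def R_def using assms by (auto intro!: sum_nonneg)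
  ultimately show ?thesis using that eq by blast
qed

text \<open>\<open>A ^ m / M ^ q\<close> equals \<open>T + R / V ^ q\<close> with a remainder of at
  most 1/8. Replacing the powers by \<open>C\<close> and \<open>K\<close> costs relative errors of
  order \<open>m / A\<close> and \<open>q / M\<close>, harmless even after multiplication by
  \<open>T\<close>, because \<open>A\<close> and \<open>M\<close> are at least
  \<open>16 * m * L\<close>. As \<open>C / K\<close> is within 1/2 of \<open>L\<close>, it follows
  that \<open>L = T\<close>.\<close>

lemma lucas_u_quotient_binomial:
  fixes U V L :: int
  assumes V: "V \<ge> 8 * 2 ^ (P * X)" and L: "L > 0" and U: "U = int (P * X) * L"
    and PQ: "0 < Q" "Q < P" "0 < X"
    and A: "A = U ^ Q * (V + 1)" and M: "M = U ^ P * V"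
    and C: "C = lucas_u A (Suc (P * X))" and K: "K = lucas_u M (Suc (Q * X))"
    and CK: "2 * \<bar>C - K * L\<bar> < \<bar>K\<bar>"
  shows "V dvd L - int (P * X choose (Q * X))"
proof -
  define m q where "m = P * X" and "q = Q * X"
  have m: "q < m" "m > 0" using PQ by (auto simp: m_def q_def)
  have V16: "V \<ge> 16"
  proof -
    have "(2::int) ^ 1 \<le> 2 ^ m" using m by (intro power_increasing) auto
    then show ?thesis using V by (simp add: m_def)
  qed
  have U': "U = int m * L" by (simp add: U m_def)
  have mU: "int m \<le> U" "int q * L \<le> U" "U > 0"
    using U' m L mult_left_mono[of 1 L "int m"] by (auto intro!: mult_right_mono)
  have "16 * U \<le> U ^ 1 * V" using mU V16 by (simp add: mult.commute)
  moreover have "U ^ 1 * V \<le> M"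
    unfolding M using mU V16 PQ by (intro mult_right_mono power_increasing) auto
  moreover have "U ^ 1 * V \<le> A"
    unfolding A using mU V16 PQ by (intro mult_mono power_increasing) auto
  ultimately have AU: "16 * U \<le> A" and MU: "16 * U \<le> M" by auto
  have A2: "A \<ge> 2" "M \<ge> 2" using AU MU mU by auto
  define \<alpha> where "\<alpha> = U ^ (P * Q * X)"
  have \<alpha>: "\<alpha> > 0" using mU by (simp add: \<alpha>_def)
  have Am: "A ^ m = \<alpha> * (V + 1) ^ m" and Mq: "M ^ q = \<alpha> * V ^ q"
    by (simp_all add: A M m_def q_def \<alpha>_def power_mult_distrib ac_simps flip: power_mult)
  obtain T R where TR: "(V + 1) ^ m = T * V ^ q + R" "0 \<le> T" "0 \<le> R" "R * V \<le> 2 ^ m * V ^ q"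
    "V dvd T - int (m choose q)"
    using binomial_power_split[of V q m] V16 m by auto
  have Vq: "V ^ q > 0" using V16 by simp
  have "2 ^ m * (8 * R) \<le> R * V"
    using mult_left_mono[OF V TR(3)] by (simp add: m_def algebra_simps)
  also have "\<dots> \<le> 2 ^ m * V ^ q" by (rule TR)
  finally have R8: "8 * R \<le> V ^ q" by simp
  have "\<bar>V + 1\<bar> ^ m < \<bar>V\<bar> ^ q * (2 * \<bar>L\<bar> + 1)"
    unfolding m_def q_def
    by (rule lucas_u_quotient_bound[OF A M _ _ _ _ C K CK]) (use mU AU A2 in \<open>auto simp: m_def\<close>)
  then have "T * V ^ q < (2 * L + 1) * V ^ q"
    using TR(1,3) L V16 by (simp add: algebra_simps)
  \<comment> \<open>This crude bound lets the errors, which are proportional to \<open>T\<close>, be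
    measured against \<open>U = m * L\<close>.\<close>
  then have TL: "T \<le> 2 * L" using Vq by simp
  have C': "(A - 1) ^ m \<le> C" "C \<le> A ^ m"
    using lucas_u_lower[OF A2(1), of m] lucas_u_upper[OF A2(1), of m] C by (auto simp: m_def)
  have K': "(M - 1) ^ q \<le> K" "K \<le> M ^ q" "0 < K"
    using lucas_u_lower[OF A2(2), of q] lucas_u_upper[OF A2(2), of q] lucas_u_growth[OF A2(2), of q] K
    by (auto simp: q_def)
  have CK': "2 * (K * L) < 2 * C + K" "2 * C < 2 * (K * L) + K"
    using CK K'(3) by (smt (verit))+
  have "L < T + 1"
  proof (rule ccontr)
    assume "\<not> L < T + 1"
    then have "K * (2 * T + 1) \<le> K * (2 * L - 1)" using K' by (intro mult_left_mono) auto
    also have "\<dots> < 2 * C" using CK' by (simp add: algebra_simps)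
    also have "\<dots> \<le> 2 * (\<alpha> * (T * V ^ q + R))" using C' Am TR(1) by simp
    finally have "K * (2 * T + 1) < 2 * (\<alpha> * (T * V ^ q + R))" .
    moreover have "(M - 1) ^ q * (2 * T + 1) \<le> K * (2 * T + 1)"
      using K' TR by (intro mult_right_mono) auto
    ultimately have "(M - 1) ^ q * (2 * T + 1) * M < 2 * (\<alpha> * (T * V ^ q + R)) * M"
      using A2 by (intro mult_strict_right_mono) auto
    moreover have "M ^ q * (M - int q) * (2 * T + 1) \<le> (M - 1) ^ q * M * (2 * T + 1)"
      using A2 TR by (intro mult_right_mono power_pred_lower) auto
    ultimately have "\<alpha> * (V ^ q * (M - int q) * (2 * T + 1)) < \<alpha> * (2 * (T * V ^ q + R) * M)"
      by (simp add: Mq algebra_simps)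
    then have "V ^ q * (M - int q) * (2 * T + 1) < 2 * (T * V ^ q + R) * M"
      using \<alpha> by simp
    then have "V ^ q * (4 * (M - int q * (2 * T + 1))) < 8 * R * M"
      by (simp add: algebra_simps)
    also have "\<dots> \<le> V ^ q * M" using R8 A2 by (intro mult_right_mono) auto
    finally have "4 * (M - int q * (2 * T + 1)) < M"
      by (rule mult_left_less_imp_less) (use Vq in simp)
    moreover have "int q * (2 * T + 1) \<le> 5 * (int q * L)"
      using TL L mult_left_mono[of "2 * T + 1" "5 * L" "int q"] by simp
    \<comment> \<open>Here \<open>3 * M < 20 * U\<close>, against
      \<open>M \<ge> 16 * U\<close>.\<close>
    ultimately show False using MU mU by (smt (verit))
  qed
  moreover have "T - 1 < L"
  proof (rule ccontr)
    assume "\<not> T - 1 < L"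
    then have "K * (2 * L + 1) \<le> K * (2 * T - 1)" using K' by (intro mult_left_mono) auto
    moreover have "K * (2 * T - 1) \<le> M ^ q * (2 * T - 1)"
      using K' \<open>\<not> T - 1 < L\<close> L by (intro mult_right_mono) auto
    moreover have "2 * (A - 1) ^ m < K * (2 * L + 1)" using C' CK' by (simp add: algebra_simps)
    ultimately have "2 * (A - 1) ^ m * A < M ^ q * (2 * T - 1) * A"
      using A2 by (intro mult_strict_right_mono) auto
    moreover have "A ^ m * (A - int m) \<le> (A - 1) ^ m * A" using A2 by (intro power_pred_lower) auto
    ultimately have "2 * (A ^ m * (A - int m)) < M ^ q * (2 * T - 1) * A" by simp
    moreover have "\<alpha> * (T * V ^ q) * (A - int m) \<le> A ^ m * (A - int m)"
      unfolding Am TR(1) using \<alpha> TR(3) AU mU by (intro mult_right_mono mult_left_mono) auto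
    ultimately have "\<alpha> * V ^ q * (2 * T * (A - int m)) < \<alpha> * V ^ q * ((2 * T - 1) * A)"
      by (simp add: Mq algebra_simps)
    then have "2 * T * (A - int m) < (2 * T - 1) * A" using \<alpha> Vq by simp
    then have "A < 2 * (int m * T)" by (simp add: algebra_simps)
    moreover have "int m * T \<le> int m * (2 * L)" using TL by (intro mult_left_mono) auto
    \<comment> \<open>Here \<open>A < 4 * U\<close>, against \<open>A \<ge> 16 * U\<close>.\<close>
    ultimately show False using AU mU U' by simp
  qed
  ultimately have "L = T" by simp
  then show ?thesis using TR(5) by (simp add: m_def q_def)
qed

section \<open>The theorem\<close>

theorem theorem4p2:
  fixes p b :: nat
    and g P Q X Y :: int
    and h k l w x y :: int
    and L U V W K A B C D E F G H I :: int
  assumes "prime p" and "g > 0"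
    and "P > Q" and "Q > 0"
    and "X \<ge> 3 * int b"
    and "Y \<ge> max (int b) (int p ^ nat (4 * P))"
    and L: "L = l * Y"
    and U: "U = P * L * X"
    and V: "V = 4 * g * w * Y"
    and W: "W = int b * w"
    and K: "K = Q * X + 1 + k * (U ^ nat P * V - 2)"
    and A: "A = U ^ nat Q * (V + 1)"
    and B: "B = P * X + 1"
    and C: "C = B + (A - 2) * h"
    and D: "D = (A^2 - 4) * C^2 + 4"
    and E: "E = C^2 * D * x"
    and F: "F = 4 * (A^2 - 4) * E^2 + 1"
    and G: "G = 1 + C * D * F - 2 * (A + 2) * (A - 2)^2 * E^2"
    and H: "H = C + B * F + (2 * y - 1) * C * F"
    and I: "I = (G^2 - 1) * H^2 + 1"
    and "l * x \<noteq> 0"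
    and "is_square (D * F * I)"
    and "is_square ((U ^ nat (2 * P) * V^2 - 4) * K^2 + 4)"
    and "(int p * A - (int p)^2 - 1) dvd
           (((int p)^2 - 1) * W * C - int p * (W^2 - 1))"
    and "4 * (C - K * L)^2 < K^2"
  shows "b \<in> powers_of p \<and> Y dvd int (nat (P * X) choose nat (Q * X))"
proof -
  obtain P' Q' X' where PQX: "P = int P'" "Q = int Q'" "X = int X'"
    using assms(3-5) zero_le_imp_eq_int[of P] zero_le_imp_eq_int[of Q] zero_le_imp_eq_int[of X] by force
  define m q where "m = P' * X'" and "q = Q' * X'"
  have PQ': "Q' < P'" "0 < Q'" "2 \<le> P'" using assms(3,4) by (auto simp: PQX)
  have nats: "nat P = P'" "nat Q = Q'" "nat (2 * P) = 2 * P'" "nat (4 * P) = 4 * P'"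
    "nat (P * X) = m" "nat (Q * X) = q"
    by (simp_all add: PQX m_def q_def nat_mult_distrib)
  have p2: "int p \<ge> 2" using prime_ge_2_nat[OF assms(1)] by simp
  have Yp: "Y \<ge> int p ^ (4 * P')" and Yb: "Y \<ge> int b" using assms(6) by (auto simp: nats)
  have "int p ^ 8 \<le> int p ^ (4 * P')" using p2 PQ' by (intro power_increasing) auto
  then have Yp8: "int p ^ 8 \<le> Y" using Yp by simp
  have "2 ^ 8 \<le> int p ^ 8" using p2 by (intro power_mono) auto
  then have Y256: "256 \<le> Y" using Yp8 by simp
  have YP: "int P' \<le> Y"
  proof -
    have "int P' < 2 ^ P'" by (metis less_exp of_nat_less_iff of_nat_numeral of_nat_power)
    also have "\<dots> \<le> int p ^ P'" using p2 by (intro power_mono) auto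
    also have "\<dots> \<le> int p ^ (4 * P')" using p2 by (intro power_increasing) auto
    finally show ?thesis using Yp by linarith
  qed
  have L0: "L \<noteq> 0" using assms(21) Y256 by (auto simp: L)
  have YL: "Y \<le> \<bar>L\<bar>"
    using assms(21) Y256 mult_right_mono[of 1 "\<bar>l\<bar>" Y] by (auto simp: L abs_mult)
  have Uabs: "\<bar>U\<bar> = int m * \<bar>L\<bar>"
    by (simp add: U PQX m_def abs_mult)
  have A': "A = U ^ Q' * (V + 1)" using A nats by simp
  have V1: "1 \<le> \<bar>V + 1\<bar>"
  proof -
    have "4 dvd V" by (simp add: V)
    then have "V + 1 \<noteq> 0" by presburger
    then show ?thesis by simp
  qed
  \<comment> \<open>For \<open>W = 0\<close> the modulus would divide \<open>p\<close>, but
    \<open>A\<close> is 0 or at least \<open>p ^ 8\<close> in size. Nonzero \<open>W\<close> yields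
    \<open>b \<ge> 1\<close>, and with it \<open>X \<ge> 3\<close>.\<close>
  have W0: "W \<noteq> 0"
  proof
    assume "W = 0"
    then have "int p * A - (int p)\<^sup>2 - 1 dvd int p" using assms(24) by simp
    then have "\<bar>int p * A - (int p)\<^sup>2 - 1\<bar> \<le> int p"
      using dvd_imp_le_int[of "int p"] p2 by fastforce
    then have le: "\<bar>int p * A\<bar> \<le> (int p)\<^sup>2 + int p + 1"
      using zero_le_power2[of "int p"] by linarith
    show False
    proof (cases "m = 0")
      case True
      then have "A = 0" using Uabs PQ' by (simp add: A')
      then show False using \<open>\<bar>int p * A - (int p)\<^sup>2 - 1\<bar> \<le> int p\<close> p2
        by (simp add: power2_eq_square) (smt (verit) mult_le_cancel_left1)
    next
      case False
      then have "1 * \<bar>L\<bar> \<le> \<bar>U\<bar>" unfolding Uabs by (intro mult_right_mono) auto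
      then have "int p ^ 8 \<le> \<bar>U\<bar>" using Yp8 YL by simp
      moreover have "\<bar>U\<bar> ^ 1 \<le> \<bar>U\<bar> ^ Q'"
        using PQ' \<open>1 * \<bar>L\<bar> \<le> \<bar>U\<bar>\<close> L0 by (intro power_increasing) auto
      moreover have "\<bar>U\<bar> ^ Q' * 1 \<le> \<bar>A\<bar>"
        unfolding A' abs_mult power_abs using V1 by (intro mult_left_mono) auto
      ultimately have "int p ^ 8 \<le> \<bar>A\<bar>" by simp
      moreover have "int p * 128 \<le> int p * int p ^ 7"
        using power_mono[OF p2, of 7] by (intro mult_left_mono) auto
      moreover have "int p * int p ^ 7 = int p ^ 8" by (simp flip: power_Suc)
      ultimately have "int p + 2 \<le> \<bar>A\<bar>" using p2 by linarith
      then have "int p * (int p + 2) \<le> \<bar>int p * A\<bar>"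
        unfolding abs_mult by (simp add: mult_left_mono)
      moreover have "int p * (int p + 2) = (int p)\<^sup>2 + 2 * int p"
        by (simp add: power2_eq_square algebra_simps)
      ultimately show False using le p2 by linarith
    qed
  qed
  then have b1: "b \<ge> 1" and w0: "w \<noteq> 0" by (auto simp: W)

  \<comment> \<open>Size estimates, in absolute values since signs are still open\<close>
  have X3: "X' \<ge> 3" using assms(5) b1 by (simp add: PQX)
  have m6: "m \<ge> 6" using mult_le_mono[OF PQ'(3) X3] by (simp add: m_def)
  have qm: "q \<le> m" using PQ' by (simp add: m_def q_def)
  have wY: "\<bar>w\<bar> * Y \<ge> Y" "\<bar>w\<bar> * Y \<ge> \<bar>W\<bar>"
  proof -
    show "\<bar>w\<bar> * Y \<ge> Y" using w0 Y256 mult_right_mono[of 1 "\<bar>w\<bar>" Y] by simp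
    show "\<bar>w\<bar> * Y \<ge> \<bar>W\<bar>"
      using Yb mult_left_mono[of "int b" Y "\<bar>w\<bar>"] by (simp add: W abs_mult mult.commute)
  qed
  have gwY: "\<bar>V\<bar> \<ge> 4 * (\<bar>w\<bar> * Y)"
    using assms(2) Y256 mult_right_mono[of 1 g "\<bar>w\<bar> * Y"] by (simp add: V abs_mult)
  \<comment> \<open>The factor 4 in \<open>V\<close> leaves room to subtract \<open>P'\<close>:
    \<open>z\<close> still dominates \<open>Y\<close> and \<open>\<bar>W\<bar>\<close>, and
    \<open>z ^ X'\<close> will bound \<open>2 * \<bar>L\<bar>\<close> from below.\<close>
  define z where "z = \<bar>V\<bar> - int P'"
  have z: "Y \<le> z" "\<bar>W\<bar> \<le> z" "z \<le> \<bar>V\<bar> - 1"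
    unfolding z_def using gwY wY YP Y256 PQ'(3) by linarith+
  have U256: "256 * int m \<le> \<bar>U\<bar>"
    unfolding Uabs using YL Y256 mult_left_mono[of 256 "\<bar>L\<bar>" "int m"] by simp
  have UL: "6 * \<bar>L\<bar> \<le> \<bar>U\<bar>"
    unfolding Uabs using m6 by (intro mult_right_mono) auto
  have U1: "4 \<le> \<bar>U\<bar>" using U256 m6 by simp
  have "\<bar>U\<bar> ^ 1 * (\<bar>V\<bar> - 1) \<le> \<bar>U\<bar> ^ Q' * \<bar>V + 1\<bar>"
    using U1 PQ' z Y256 by (intro mult_mono power_increasing) auto
  then have Alow: "\<bar>U\<bar> * (\<bar>V\<bar> - 1) \<le> \<bar>A\<bar>" by (simp add: A' abs_mult power_abs)
  moreover have "\<bar>U\<bar> * 1 \<le> \<bar>U\<bar> * (\<bar>V\<bar> - 1)" using z Y256 by (intro mult_left_mono) auto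
  ultimately have A256: "256 * int m \<le> \<bar>A\<bar>" using U256 by simp
  define M where "M = U ^ P' * V"
  have AM: "2 * \<bar>A\<bar> \<le> \<bar>M\<bar>"
  proof -
    have "2 * \<bar>A\<bar> = \<bar>U\<bar> ^ Q' * (2 * \<bar>V + 1\<bar>)" by (simp add: A' abs_mult power_abs)
    also have "\<dots> \<le> \<bar>U\<bar> ^ Q' * (\<bar>U\<bar> * \<bar>V\<bar>)"
    proof (rule mult_left_mono)
      have "4 * \<bar>V\<bar> \<le> \<bar>U\<bar> * \<bar>V\<bar>" using U1 by (intro mult_right_mono) auto
      then show "2 * \<bar>V + 1\<bar> \<le> \<bar>U\<bar> * \<bar>V\<bar>"
        using z Y256 abs_triangle_ineq[of V 1] by (smt (verit))
    qed simp
    also have "\<dots> = \<bar>U\<bar> ^ Suc Q' * \<bar>V\<bar>" by simp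
    also have "\<dots> \<le> \<bar>U\<bar> ^ P' * \<bar>V\<bar>"
      using U1 PQ' by (intro mult_right_mono power_increasing) auto
    finally show ?thesis by (simp add: M_def abs_mult power_abs)
  qed
  have A2: "\<bar>A\<bar> \<ge> 2" "\<bar>A\<bar> \<ge> 2 * int m + 5" using A256 m6 by auto
  have M2: "\<bar>M\<bar> \<ge> 2" using AM A2(1) by linarith

  \<comment> \<open>Identification of \<open>C\<close> and \<open>K\<close> as Lucas terms\<close>
  have Bm: "B = int (Suc m)" by (simp add: B PQX m_def)
  have "C = lucas_u A (nat B)"
    by (rule lucas_u_relation[OF _ _ _ _ D E F G H I assms(22)])
      (use A2 m6 assms(21) in \<open>auto simp: Bm C\<close>)
  then have Cu: "C = lucas_u A (Suc m)" by (simp only: Bm nat_int)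
  have CK: "2 * \<bar>C - K * L\<bar> < \<bar>K\<bar>"
  proof -
    have "(2 * (C - K * L))\<^sup>2 < K\<^sup>2" using assms(25) unfolding power_mult_distrib by simp
    then have "\<bar>2 * (C - K * L)\<bar> < \<bar>K\<bar>" by (metis abs_le_square_iff linorder_not_less)
    then show ?thesis by (simp only: abs_mult abs_numeral)
  qed
  have Ku: "K = lucas_u M (Suc q)"
  proof (rule lucas_u_quotient_index[OF A2(1) _ _ qm Cu _ _ L0 CK])
    have "U ^ (2 * P') * V\<^sup>2 = M\<^sup>2"
      by (simp add: M_def power_mult_distrib mult.commute flip: power_mult)
    then show "is_square ((M\<^sup>2 - 4) * K\<^sup>2 + 4)" using assms(23) by (simp add: nats)
    show "M - 2 dvd K - int (Suc q)" by (simp add: K nats M_def PQX q_def)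
  qed (use AM A2 qm in auto)

  \<comment> \<open>Lower bounds for \<open>L\<close> and \<open>A\<close>, and \<open>b\<close> as
    a power of \<open>p\<close>\<close>
  have bound: "\<bar>V + 1\<bar> ^ m < \<bar>V\<bar> ^ q * (2 * \<bar>L\<bar> + 1)"
    unfolding m_def q_def
    by (rule lucas_u_quotient_bound[OF A' M_def _ A2(1) _ M2 _ _ CK])
      (use U1 A2 AM Cu Ku in \<open>auto simp: m_def q_def\<close>)
  have "(\<bar>V\<bar> - 1) ^ m \<le> \<bar>V + 1\<bar> ^ m" using z Y256 by (intro power_mono) auto
  then have zX: "z ^ X' \<le> 2 * \<bar>L\<bar>"
    unfolding z_def using bound z Y256 PQ'
    by (intro power_quotient_lower[of Q' P']) (auto simp: m_def q_def z_def)
  have W': "W = int p ^ Suc m"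
    unfolding m_def
  proof (rule power_unique_solution[OF p2 PQ'(3) X3])
    show "int p ^ (4 * P') \<le> z" using Yp z by simp
    have "3 * z ^ Suc X' = (3 * z ^ X') * z" by simp
    also have "\<dots> \<le> (6 * \<bar>L\<bar>) * z" using zX z Y256 by (intro mult_right_mono) auto
    also have "\<dots> \<le> \<bar>U\<bar> * (\<bar>V\<bar> - 1)" using UL z Y256 by (intro mult_mono) auto
    also have "\<dots> \<le> \<bar>A\<bar>" by (rule Alow)
    finally show "3 * z ^ Suc X' \<le> \<bar>A\<bar>" .
    show "int p * A - (int p)\<^sup>2 - 1 dvd
        (W - int p ^ Suc (P' * X')) * (int p ^ Suc (P' * X') * W + 1)"
      using lucas_u_power_factor_dvd[OF Cu assms(24)] by (simp only: m_def)
  qed (use z W0 in auto)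
  have "int b dvd int (p ^ Suc m)" using W' W by (metis dvd_triv_left of_nat_power)
  then have "b dvd p ^ Suc m" by (simp only: of_nat_dvd_iff)
  then obtain i where "b = p ^ i" using divides_primepow_nat[OF assms(1)] by blast
  then have bp: "b \<in> powers_of p" by (auto simp: powers_of_def)

  \<comment> \<open>Signs, and the binomial coefficient\<close>
  have "W > 0" using W' p2 by simp
  then have "w > 0" using b1 by (simp add: W zero_less_mult_iff)
  have "V > 0" using \<open>w > 0\<close> assms(2) Y256 by (simp add: V)
  have "2 ^ Suc m \<le> W" unfolding W' using p2 by (intro power_mono) auto
  \<comment> \<open>\<open>V\<close> is at least \<open>4 * W\<close>, and \<open>W\<close> is a
    power with exponent \<open>m + 1\<close>.\<close>
  then have V8: "8 * 2 ^ m \<le> V" using gwY wY(2) \<open>V > 0\<close> by simp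
  have sgn_power: "sgn (a ^ n) = sgn a ^ n" for a :: int and n
    by (induction n) (simp_all add: sgn_mult)
  \<comment> \<open>Both signs equal that of \<open>U\<close> raised to \<open>P' * Q' * X'\<close>.
    So \<open>C / K\<close> is positive, and \<open>L\<close>, being within 1/2 of it and nonzero,
    is positive too.\<close>
  have "sgn C = sgn K"
  proof -
    have "sgn C = sgn A ^ m" "sgn K = sgn M ^ q"
      unfolding Cu Ku using sgn_lucas_u A2(1) M2 by auto
    moreover have "sgn A = sgn U ^ Q'" "sgn M = sgn U ^ P'"
      using \<open>V > 0\<close> by (simp_all add: A' M_def sgn_mult sgn_power)
    ultimately show ?thesis by (simp add: m_def q_def ac_simps flip: power_mult)
  qed
  have "L > 0"
  proof (rule ccontr)
    assume "\<not> L > 0"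
    then have L1: "L \<le> - 1" using L0 by simp
    show False
    proof (cases "K > 0")
      case True
      then have "C > 0" using \<open>sgn C = sgn K\<close> by (simp add: sgn_1_pos)
      moreover have "K * L \<le> - K" using True L1 mult_left_mono[of L "- 1" K] by simp
      ultimately show False using CK True by (smt (verit))
    next
      case False
      moreover have "K \<noteq> 0" using CK by auto
      ultimately have "K < 0" by simp
      then have "C < 0" using \<open>sgn C = sgn K\<close> by (simp add: sgn_1_neg)
      moreover have "K * L \<ge> - K" using \<open>K < 0\<close> L1 mult_left_mono_neg[of L "- 1" K] by simp
      ultimately show False using CK \<open>K < 0\<close> by (smt (verit))
    qed
  qed
  have "V dvd L - int (P' * X' choose (Q' * X'))"
  proof (rule lucas_u_quotient_binomial[OF _ \<open>L > 0\<close> _ PQ'(2,1) _ A' M_def _ _ CK])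
    show "U = int (P' * X') * L" by (simp add: U PQX)
  qed (use V8 X3 Cu Ku in \<open>auto simp: m_def q_def\<close>)
  moreover have "Y dvd V" "Y dvd L" by (simp_all add: V L)
  ultimately have "Y dvd L - (L - int (m choose q))"
    unfolding m_def q_def by (meson dvd_diff dvd_trans)
  then show ?thesis using bp by (simp add: nats)
qed

end
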